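(* Let $(M,g)$ be a $3$-dimensional Riemannian manifold. If some metric $\tilde g$ in the conformal class $[g]$ admits a nowhere vanishing parallel vector field, then for every $p\in M$ there is a nonzero tangent vector $v\in T_pM$ such that the Cotton–York tensor $CY$ of $g$ satisfies $$CY_p(v,v)=0\quad\text{and}\quad CY_p(w_1,w_2)=0$$ for every pair of vectors $w_1,w_2\in v^\perp$.
   Context: The conformal class is $[g]=\{e^{2f}g: f\in C^\infty(M)\}$. A vector field $X$ is parallel for $\tilde g$ if $\tilde\nabla X=0$, with $\tilde\nabla$ the Levi-Civita connection of $\tilde g$. In dimension $3$ the Schouten tensor is $S=\mathrm{Ric}-\frac{s}{4}g$ ($s$ the scalar curvature), the Cotton tensor is $C_{ijk}=(\nabla_iS)_{jk}-(\nabla_jS)_{ik}$, and the Cotton–York tensor is the $(0,2)$ tensor given in local oriented coordinates by $$CY_{ij}=\tfrac12\, C_{kli}\,g_{jm}\,\frac{\epsilon^{klm}}{\sqrt{\det g}}$$ (summation over repeated indices), where $\epsilon^{klm}\in\{0,1,-1\}$ is the signature of $(k,l,m)$. It is symmetric and trace-free; changing the local orientation changes its sign. $v^\perp\subset T_pM$ denotes the orthogonal complement of $v$. *)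

theory Defs
  imports "HOL-Analysis.Analysis"
begin

section \<open>Smooth maps between open subsets of normed spaces\<close>

text \<open>Only used for open \<open>U\<close>, where \<open>frechet_derivative f (at x)\<close> is determined by \<open>f\<close> on \<open>U\<close>.\<close>

primrec Ck_on :: "nat \<Rightarrow> ('a::real_normed_vector \<Rightarrow> 'b::real_normed_vector) \<Rightarrow> 'a set \<Rightarrow> bool" where
  "Ck_on 0 f U \<longleftrightarrow> continuous_on U f"
| "Ck_on (Suc k) f U \<longleftrightarrow>
     (\<forall>x\<in>U. f differentiable (at x)) \<and>
     (\<forall>h. Ck_on k (\<lambda>x. frechet_derivative f (at x) h) U)"

definition smooth_on :: "('a::real_normed_vector \<Rightarrow> 'b::real_normed_vector) \<Rightarrow> 'a set \<Rightarrow> bool" where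
  "smooth_on f U \<longleftrightarrow> (\<forall>k. Ck_on k f U)"

definition pderiv_vec :: "'n \<Rightarrow> (real^'n \<Rightarrow> real) \<Rightarrow> real^'n \<Rightarrow> real" where
  "pderiv_vec i f x = frechet_derivative f (at x) (axis i 1)"


section \<open>Smooth manifolds\<close>

text \<open>A chart is a domain together with its coordinate map; the values of the map outside the
  domain are irrelevant.\<close>

type_synonym ('a, 'n) chart = "'a set \<times> ('a \<Rightarrow> real^'n)"

abbreviation chart_dom :: "('a, 'n::finite) chart \<Rightarrow> 'a set" where
  "chart_dom c \<equiv> fst c"

abbreviation chart_map :: "('a, 'n::finite) chart \<Rightarrow> 'a \<Rightarrow> real^'n" where
  "chart_map c \<equiv> snd c"

definition chart_image :: "('a, 'n::finite) chart \<Rightarrow> (real^'n) set" where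
  "chart_image c = chart_map c ` chart_dom c"

definition chart_inv :: "('a, 'n::finite) chart \<Rightarrow> real^'n \<Rightarrow> 'a" where
  "chart_inv c = inv_into (chart_dom c) (chart_map c)"

definition is_chart :: "'a topology \<Rightarrow> ('a, 'n::finite) chart \<Rightarrow> bool" where
  "is_chart M c \<longleftrightarrow>
     openin M (chart_dom c) \<and> open (chart_image c) \<and>
     homeomorphic_map (subtopology M (chart_dom c)) (top_of_set (chart_image c)) (chart_map c)"

definition transition ::
    "('a, 'n::finite) chart \<Rightarrow> ('a, 'n) chart \<Rightarrow> real^'n \<Rightarrow> real^'n" where
  "transition c c' = chart_map c' \<circ> chart_inv c"

text \<open>The atlas \<open>A\<close> need not be maximal; in particular it may be.\<close>

definition smooth_manifold :: "'a topology \<Rightarrow> ('a, 'n::finite) chart set \<Rightarrow> bool" where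
  "smooth_manifold M A \<longleftrightarrow>
     Hausdorff_space M \<and> second_countable M \<and>
     (\<forall>c\<in>A. is_chart M c) \<and> (\<Union>c\<in>A. chart_dom c) = topspace M \<and>
     (\<forall>c\<in>A. \<forall>c'\<in>A. smooth_on (transition c c') (chart_map c ` (chart_dom c \<inter> chart_dom c')))"

definition smooth_fun :: "('a, 'n::finite) chart set \<Rightarrow> ('a \<Rightarrow> real) \<Rightarrow> bool" where
  "smooth_fun A f \<longleftrightarrow> (\<forall>c\<in>A. smooth_on (f \<circ> chart_inv c) (chart_image c))"


section \<open>Tangent vectors, vector fields and Riemannian metrics\<close>

text \<open>A tangent vector at \<open>p\<close> assigns to each chart of the atlas around \<open>p\<close> a vector of components,
  with components in different charts related by the Jacobian of the transition map. For other
  charts the value is normalised to zero, so that equality of tangent vectors is equality of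
  functions.\<close>

type_synonym ('a, 'n) tangent = "('a, 'n) chart \<Rightarrow> real^'n"

definition tangent_space ::
    "('a, 'n::finite) chart set \<Rightarrow> 'a \<Rightarrow> ('a, 'n) tangent set" where
  "tangent_space A p =
     {v. (\<forall>c\<in>A. \<forall>c'\<in>A. p \<in> chart_dom c \<inter> chart_dom c' \<longrightarrow>
            v c' = frechet_derivative (transition c c') (at (chart_map c p)) (v c)) \<and>
         (\<forall>c. \<not> (c \<in> A \<and> p \<in> chart_dom c) \<longrightarrow> v c = 0)}"

definition tangent_zero :: "('a, 'n::finite) tangent" where
  "tangent_zero = (\<lambda>c. 0)"

definition tangent_add ::
    "('a, 'n::finite) tangent \<Rightarrow> ('a, 'n) tangent \<Rightarrow> ('a, 'n) tangent" where
  "tangent_add v w = (\<lambda>c. v c + w c)"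

definition tangent_scale :: "real \<Rightarrow> ('a, 'n::finite) tangent \<Rightarrow> ('a, 'n) tangent" where
  "tangent_scale a v = (\<lambda>c. a *\<^sub>R v c)"

text \<open>The coordinate vector \<open>\<partial>/\<partial>x\<^sup>i\<close> at \<open>p\<close> of the chart \<open>c\<close>.\<close>

definition coord_vector ::
    "('a, 'n::finite) chart set \<Rightarrow> ('a, 'n) chart \<Rightarrow> 'n \<Rightarrow> 'a \<Rightarrow> ('a, 'n) tangent" where
  "coord_vector A c i p =
     (\<lambda>c'. if c' \<in> A \<and> p \<in> chart_dom c'
           then frechet_derivative (transition c c') (at (chart_map c p)) (axis i 1) else 0)"

definition vector_field ::
    "'a topology \<Rightarrow> ('a, 'n::finite) chart set \<Rightarrow> ('a \<Rightarrow> ('a, 'n) tangent) \<Rightarrow> bool" where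
  "vector_field M A X \<longleftrightarrow>
     (\<forall>p\<in>topspace M. X p \<in> tangent_space A p) \<and>
     (\<forall>c\<in>A. smooth_on (\<lambda>x. X (chart_inv c x) c) (chart_image c))"

type_synonym ('a, 'n) metric = "'a \<Rightarrow> ('a, 'n) tangent \<Rightarrow> ('a, 'n) tangent \<Rightarrow> real"

text \<open>The coefficient matrix \<open>g\<^sub>i\<^sub>j\<close> as a function of the coordinates of the chart \<open>c\<close>.\<close>

definition metric_coeff ::
    "('a, 'n::finite) chart set \<Rightarrow> ('a, 'n) metric \<Rightarrow> ('a, 'n) chart \<Rightarrow> real^'n \<Rightarrow> real^'n^'n" where
  "metric_coeff A g c x =
     (\<chi> i j. let p = chart_inv c x in g p (coord_vector A c i p) (coord_vector A c j p))"

definition inner_product_on_tangent ::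
    "('a, 'n::finite) chart set \<Rightarrow> ('a, 'n) metric \<Rightarrow> 'a \<Rightarrow> bool" where
  "inner_product_on_tangent A g p \<longleftrightarrow>
     (\<forall>u\<in>tangent_space A p. \<forall>v\<in>tangent_space A p. g p u v = g p v u) \<and>
     (\<forall>u\<in>tangent_space A p. \<forall>v\<in>tangent_space A p. \<forall>w\<in>tangent_space A p.
        g p (tangent_add u v) w = g p u w + g p v w) \<and>
     (\<forall>a. \<forall>u\<in>tangent_space A p. \<forall>v\<in>tangent_space A p.
        g p (tangent_scale a u) v = a * g p u v) \<and>
     (\<forall>v\<in>tangent_space A p. v \<noteq> tangent_zero \<longrightarrow> g p v v > 0)"

definition riemannian_metric ::
    "'a topology \<Rightarrow> ('a, 'n::finite) chart set \<Rightarrow> ('a, 'n) metric \<Rightarrow> bool" where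
  "riemannian_metric M A g \<longleftrightarrow>
     (\<forall>p\<in>topspace M. inner_product_on_tangent A g p) \<and>
     (\<forall>c\<in>A. smooth_on (metric_coeff A g c) (chart_image c))"

definition conformal_class ::
    "('a, 'n::finite) chart set \<Rightarrow> ('a, 'n) metric \<Rightarrow> ('a, 'n) metric set" where
  "conformal_class A g = {(\<lambda>p v w. exp (2 * f p) * g p v w) | f. smooth_fun A f}"

definition orth_compl ::
    "('a, 'n::finite) chart set \<Rightarrow> ('a, 'n) metric \<Rightarrow> 'a \<Rightarrow> ('a, 'n) tangent \<Rightarrow> ('a, 'n) tangent set"
  where "orth_compl A g p v = {w \<in> tangent_space A p. g p v w = 0}"


section \<open>Levi-Civita connection and curvature in local coordinates\<close>

text \<open>Here \<open>G\<close> is the coefficient matrix of a metric as a function on an open subset of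
  \<open>\<real>\<^sup>n\<close>.\<close>

text \<open>\<open>christoffel G k i j\<close> is \<open>\<Gamma>\<^sup>k\<^sub>i\<^sub>j\<close>, that is \<open>\<nabla>\<^sub>i \<partial>\<^sub>j = \<Sum>\<^sub>k \<Gamma>\<^sup>k\<^sub>i\<^sub>j \<partial>\<^sub>k\<close>.\<close>

definition christoffel ::
    "(real^'n \<Rightarrow> real^'n^'n) \<Rightarrow> 'n \<Rightarrow> 'n \<Rightarrow> 'n \<Rightarrow> real^'n \<Rightarrow> real" where
  "christoffel G k i j x =
     1/2 * (\<Sum>l\<in>UNIV. matrix_inv (G x) $ k $ l *
       (pderiv_vec i (\<lambda>y. G y $ j $ l) x + pderiv_vec j (\<lambda>y. G y $ i $ l) x
         - pderiv_vec l (\<lambda>y. G y $ i $ j) x))"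

text \<open>Torsion-freeness and compatibility with the metric, the two properties characterising the
  Levi-Civita connection.\<close>

lemma pderiv_vec_cong:
  assumes "open U" "x \<in> U" "\<And>y. y \<in> U \<Longrightarrow> f y = h y"
  shows "pderiv_vec i f x = pderiv_vec i h x"
proof -
  have "(f has_derivative D) (at x) \<longleftrightarrow> (h has_derivative D) (at x)" for D
    using has_derivative_transform_within_open[OF _ assms(1,2)] assms(3) by metis
  then show ?thesis by (simp add: pderiv_vec_def frechet_derivative_def)
qed

lemma christoffel_torsion_free:
  assumes "open U" "x \<in> U" "\<And>y i j. y \<in> U \<Longrightarrow> G y $ i $ j = G y $ j $ i"
  shows "christoffel G k i j x = christoffel G k j i x"
proof -
  have "pderiv_vec l (\<lambda>y. G y $ i $ j) x = pderiv_vec l (\<lambda>y. G y $ j $ i) x" for l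
    using assms by (intro pderiv_vec_cong[of U]) auto
  then show ?thesis by (simp add: christoffel_def add.commute)
qed

lemma christoffel_metric_compatible:
  assumes "open U" "x \<in> U" "\<And>y i j. y \<in> U \<Longrightarrow> G y $ i $ j = G y $ j $ i" "invertible (G x)"
  shows "pderiv_vec i (\<lambda>y. G y $ j $ k) x =
    (\<Sum>m\<in>UNIV. christoffel G m i j x * G x $ m $ k) + (\<Sum>m\<in>UNIV. christoffel G m i k x * G x $ j $ m)"
proof -
  have sym: "pderiv_vec l (\<lambda>y. G y $ a $ b) x = pderiv_vec l (\<lambda>y. G y $ b $ a) x" for l a b
    using assms by (intro pderiv_vec_cong[of U]) auto
  have "\<exists>B. G x ** B = mat 1 \<and> B ** G x = mat 1"
    using assms(4) by (simp add: invertible_def)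
  then have inv: "G x ** matrix_inv (G x) = mat 1"
    unfolding matrix_inv_def by (metis (mono_tags, lifting) someI_ex)
  define D where "D a b l = pderiv_vec a (\<lambda>y. G y $ b $ l) x + pderiv_vec b (\<lambda>y. G y $ a $ l) x
         - pderiv_vec l (\<lambda>y. G y $ a $ b) x" for a b l
  have lower: "(\<Sum>m\<in>UNIV. christoffel G m a b x * G x $ d $ m) = 1/2 * D a b d" for a b d
  proof -
    have "(\<Sum>m\<in>UNIV. christoffel G m a b x * G x $ d $ m) =
      (\<Sum>m\<in>UNIV. \<Sum>l\<in>UNIV. 1/2 * (G x $ d $ m * matrix_inv (G x) $ m $ l) * D a b l)"
      by (simp add: christoffel_def D_def sum_distrib_left sum_distrib_right mult_ac)
    also have "\<dots> = (\<Sum>l\<in>UNIV. 1/2 * (G x ** matrix_inv (G x)) $ d $ l * D a b l)"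
      by (subst sum.swap) (simp add: matrix_matrix_mult_def sum_distrib_left sum_distrib_right)
    also have "\<dots> = (\<Sum>l\<in>UNIV. if d = l then 1/2 * D a b l else 0)"
      unfolding inv by (intro sum.cong) (auto simp: mat_def)
    finally show ?thesis by simp
  qed
  have "(\<Sum>m\<in>UNIV. christoffel G m i j x * G x $ m $ k) =
      (\<Sum>m\<in>UNIV. christoffel G m i j x * G x $ k $ m)"
    using assms(2,3) by (intro sum.cong) auto
  then show ?thesis
    unfolding lower by (simp add: D_def sym[of i k j] field_simps)
qed

definition covariant_deriv_vec ::
    "(real^'n \<Rightarrow> real^'n^'n) \<Rightarrow> (real^'n \<Rightarrow> real^'n) \<Rightarrow> 'n \<Rightarrow> 'n \<Rightarrow> real^'n \<Rightarrow> real" where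
  "covariant_deriv_vec G Y i k x =
     pderiv_vec i (\<lambda>y. Y y $ k) x + (\<Sum>j\<in>UNIV. christoffel G k i j x * Y x $ j)"

definition parallel ::
    "('a, 'n::finite) chart set \<Rightarrow> ('a, 'n) metric \<Rightarrow> ('a \<Rightarrow> ('a, 'n) tangent) \<Rightarrow> bool" where
  "parallel A g X \<longleftrightarrow>
     (\<forall>c\<in>A. \<forall>x\<in>chart_image c. \<forall>i k.
        covariant_deriv_vec (metric_coeff A g c) (\<lambda>y. X (chart_inv c y) c) i k x = 0)"

text \<open>\<open>riemann G l k i j\<close> is the \<open>\<partial>\<^sub>l\<close>-component of
  \<open>R(\<partial>\<^sub>i,\<partial>\<^sub>j)\<partial>\<^sub>k = \<nabla>\<^sub>i\<nabla>\<^sub>j\<partial>\<^sub>k - \<nabla>\<^sub>j\<nabla>\<^sub>i\<partial>\<^sub>k\<close>.\<close>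

definition riemann ::
    "(real^'n \<Rightarrow> real^'n^'n) \<Rightarrow> 'n \<Rightarrow> 'n \<Rightarrow> 'n \<Rightarrow> 'n \<Rightarrow> real^'n \<Rightarrow> real" where
  "riemann G l k i j x =
     pderiv_vec i (christoffel G l j k) x - pderiv_vec j (christoffel G l i k) x
     + (\<Sum>m\<in>UNIV. christoffel G l i m x * christoffel G m j k x
                - christoffel G l j m x * christoffel G m i k x)"

definition ricci :: "(real^'n \<Rightarrow> real^'n^'n) \<Rightarrow> 'n \<Rightarrow> 'n \<Rightarrow> real^'n \<Rightarrow> real" where
  "ricci G j k x = (\<Sum>i\<in>UNIV. riemann G i k i j x)"

definition scalar_curv :: "(real^'n \<Rightarrow> real^'n^'n) \<Rightarrow> real^'n \<Rightarrow> real" where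
  "scalar_curv G x = (\<Sum>j\<in>UNIV. \<Sum>k\<in>UNIV. matrix_inv (G x) $ j $ k * ricci G j k x)"

text \<open>\<open>covariant_deriv_02 G T i j k\<close> is \<open>(\<nabla>\<^sub>i T)\<^sub>j\<^sub>k\<close>.\<close>

definition covariant_deriv_02 ::
    "(real^'n \<Rightarrow> real^'n^'n) \<Rightarrow> ('n \<Rightarrow> 'n \<Rightarrow> real^'n \<Rightarrow> real) \<Rightarrow> 'n \<Rightarrow> 'n \<Rightarrow> 'n \<Rightarrow> real^'n \<Rightarrow> real" where
  "covariant_deriv_02 G T i j k x =
     pderiv_vec i (T j k) x
     - (\<Sum>m\<in>UNIV. christoffel G m i j x * T m k x)
     - (\<Sum>m\<in>UNIV. christoffel G m i k x * T j m x)"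


section \<open>The Cotton--York tensor in dimension three\<close>

definition schouten :: "(real^3 \<Rightarrow> real^3^3) \<Rightarrow> 3 \<Rightarrow> 3 \<Rightarrow> real^3 \<Rightarrow> real" where
  "schouten G j k x = ricci G j k x - scalar_curv G x / 4 * G x $ j $ k"

definition cotton :: "(real^3 \<Rightarrow> real^3^3) \<Rightarrow> 3 \<Rightarrow> 3 \<Rightarrow> 3 \<Rightarrow> real^3 \<Rightarrow> real" where
  "cotton G i j k x =
     covariant_deriv_02 G (schouten G) i j k x - covariant_deriv_02 G (schouten G) j i k x"

text \<open>The signature of the triple \<open>(k, l, m)\<close>, read as the map \<open>1 \<mapsto> k\<close>, \<open>2 \<mapsto> l\<close>, \<open>3 \<mapsto> m\<close>.\<close>

definition eps3 :: "3 \<Rightarrow> 3 \<Rightarrow> 3 \<Rightarrow> real" where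
  "eps3 k l m =
     (let \<sigma> = (\<lambda>a. (vector [k, l, m] :: 3^3) $ a)
      in if \<sigma> permutes UNIV then of_int (sign \<sigma>) else 0)"

definition cotton_york_coeff :: "(real^3 \<Rightarrow> real^3^3) \<Rightarrow> 3 \<Rightarrow> 3 \<Rightarrow> real^3 \<Rightarrow> real" where
  "cotton_york_coeff G i j x =
     1/2 * (\<Sum>k\<in>UNIV. \<Sum>l\<in>UNIV. \<Sum>m\<in>UNIV.
       cotton G k l i x * G x $ j $ m * (eps3 k l m / sqrt (det (G x))))"

text \<open>The Cotton--York tensor at \<open>p\<close> as a bilinear form on tangent vectors, with respect to the
  local orientation given by the chart \<open>c\<close> around \<open>p\<close>.\<close>

definition cotton_york ::
    "('a, 3) chart set \<Rightarrow> ('a, 3) metric \<Rightarrow> ('a, 3) chart \<Rightarrow> 'a \<Rightarrow>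
     ('a, 3) tangent \<Rightarrow> ('a, 3) tangent \<Rightarrow> real" where
  "cotton_york A g c p v w =
     (\<Sum>i\<in>UNIV. \<Sum>j\<in>UNIV.
       cotton_york_coeff (metric_coeff A g c) i j (chart_map c p) * v c $ i * w c $ j)"

end

theory Submission
  imports Defs
begin

text \<open>The vector \<open>v\<close> is the value at \<open>p\<close> of the vector field \<open>Y\<close> that is parallel for \<open>g'\<close>, and everything is
  computed in one chart. Since \<open>R(\<cdot>,\<cdot>)Y = 0\<close>, in dimension three the curvature tensor of \<open>g'\<close> has only one
  free component, so that \<open>Ric = \<rho> (|Y|\<^sup>2 g' - Y \<otimes> Y)\<close> for a function \<open>\<rho>\<close>, and the second Bianchi identity
  contracted with \<open>Y\<close> gives \<open>d\<rho>(Y) = 0\<close>. The Cotton tensor is conformally invariant, so that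
  \<open>C = d\<rho> \<and> (|Y|\<^sup>2 g' / 2 - Y \<otimes> Y)\<close> is also the Cotton tensor of \<open>g\<close>. Hence \<open>CY(w\<^sub>1, w\<^sub>2)\<close> is, up to a
  factor, the triple product of \<open>d\<rho>\<close>, \<open>|Y|\<^sup>2 w\<^sub>1 / 2 - \<langle>Y, w\<^sub>1\<rangle> Y\<close> and \<open>w\<^sub>2\<close>. It vanishes for
  \<open>w\<^sub>1 = w\<^sub>2 = Y\<close>, and for \<open>w\<^sub>1, w\<^sub>2 \<bottom> Y\<close> because all three covectors annihilate \<open>Y\<close>.\<close>

section \<open>Smooth functions\<close>

text \<open>The curvature step works without adapted frames and without splitting the metric: in
  dimension three the two-forms killed by a given nonzero vector form a line, so each pair of
  indices of the curvature tensor is governed by a single two-form. The function \<rho> is the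
  sectional curvature of the plane orthogonal to Y, divided by |Y|^2. Its scalar curvature is s = 2
  \<rho> |Y|^2, and subtracting s/4 times the metric from Ric is what halves the coefficient |Y|^2
  in the Cotton tensor. The metric and the one-form dual to Y are parallel, so only \<rho> gets
  differentiated. The conformal change is read backwards: the base metric is the one with the
  parallel field, and the given metric arises from it with exponent -f. The Schouten tensor of the
  given metric is then explicit in \<rho>, Y and the derivatives of the exponent, and the invariance
  of the Cotton tensor becomes an algebraic cancellation in which this explicit curvature stands in
  for the vanishing of the Weyl tensor.\<close>

lemma has_derivative_frechet:
  "f differentiable (at x) \<Longrightarrow> (f has_derivative frechet_derivative f (at x)) (at x)"
  by (simp add: frechet_derivative_works)

lemma frechet_derivative_cong_open:
  assumes "open U" "x \<in> U" "\<And>y. y \<in> U \<Longrightarrow> f y = g y"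
  shows "frechet_derivative f (at x) = frechet_derivative g (at x)"
proof -
  have "(f has_derivative D) (at x) \<longleftrightarrow> (g has_derivative D) (at x)" for D
    using has_derivative_transform_within_open[OF _ assms(1,2)] assms(3) by metis
  then show ?thesis by (simp add: frechet_derivative_def)
qed

text \<open>A derivative at a point of an open set sees only nearby values, so the total functions
  used here may be arbitrary off \<open>U\<close>.\<close>

lemma Ck_on_cong:
  assumes "open U" "\<And>y. y \<in> U \<Longrightarrow> f y = g y" "Ck_on k f U"
  shows "Ck_on k g U"
  using assms(2,3)
proof (induction k arbitrary: f g)
  case 0
  then show ?case by (simp cong: continuous_on_cong)
next
  case (Suc k)
  have eq: "frechet_derivative f (at x) = frechet_derivative g (at x)" if "x \<in> U" for x
    using frechet_derivative_cong_open[OF assms(1) that] Suc.prems(1) by blast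
  have "g differentiable (at x)" if "x \<in> U" for x
    using Suc.prems that has_derivative_transform_within_open[OF _ assms(1) that]
    by (fastforce simp: differentiable_def)
  moreover have "Ck_on k (\<lambda>x. frechet_derivative g (at x) h) U" for h
  proof (rule Suc.IH)
    show "Ck_on k (\<lambda>x. frechet_derivative f (at x) h) U"
      using Suc.prems(2) by simp
  qed (simp add: eq)
  ultimately show ?case by simp
qed

text \<open>Replaces \<open>frechet_derivative\<close> by an explicit formula, so that each closure
  property below is an induction on the order driven by one differentiation rule.\<close>

lemma Ck_on_SucI:
  assumes "open U" "\<And>x. x \<in> U \<Longrightarrow> (f has_derivative f' x) (at x)"
    and "\<And>h. Ck_on k (\<lambda>x. f' x h) U"
  shows "Ck_on (Suc k) f U"
proof -
  have "frechet_derivative f (at x) = f' x" if "x \<in> U" for x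
    using frechet_derivative_at[OF assms(2)[OF that]] by simp
  then have "Ck_on k (\<lambda>x. frechet_derivative f (at x) h) U" for h
    using Ck_on_cong[OF assms(1) _ assms(3)[of h]] by simp
  then show ?thesis
    using assms(2) by (auto simp: differentiable_def)
qed

text \<open>The rules for products, exponentials and inverses leave undifferentiated factors behind;
  this lowers their order to the one that the induction handles.\<close>

lemma Ck_on_Suc_imp: "Ck_on (Suc k) f U \<Longrightarrow> Ck_on k f U"
proof (induction k arbitrary: f)
  case 0
  then show ?case
    by (auto intro!: continuous_at_imp_continuous_on differentiable_imp_continuous_within)
next
  case (Suc k)
  from Suc.prems have "f differentiable (at x)" if "x \<in> U" for x
    using that by simp
  moreover have "Ck_on k (\<lambda>x. frechet_derivative f (at x) h) U" for h
    using Suc.prems by (intro Suc.IH) (simp del: Ck_on.simps(2) add: Ck_on.simps(2)[of _ f])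
  ultimately show ?case by simp
qed

lemma Ck_on_const: "open U \<Longrightarrow> Ck_on k (\<lambda>x. c) U"
  by (induction k arbitrary: c) (auto intro!: Ck_on_SucI[of _ _ "\<lambda>x h. 0"] simp del: Ck_on.simps(2))

lemma Ck_on_bounded_linear:
  assumes "bounded_linear L" "open U" "Ck_on k f U"
  shows "Ck_on k (\<lambda>x. L (f x)) U"
  using assms(3)
proof (induction k arbitrary: f)
  case 0
  then show ?case
    using bounded_linear.continuous_on[OF assms(1)] by simp
next
  case (Suc k)
  then show ?case
    by (intro Ck_on_SucI[of _ _ "\<lambda>x h. L (frechet_derivative f (at x) h)"] assms(2)
        bounded_linear.has_derivative[OF assms(1)] has_derivative_frechet) auto
qed

lemma Ck_on_add:
  assumes "open U" "Ck_on k f U" "Ck_on k g U"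
  shows "Ck_on k (\<lambda>x. f x + g x) U"
  using assms(2,3)
proof (induction k arbitrary: f g)
  case 0
  then show ?case by (simp add: continuous_on_add)
next
  case (Suc k)
  then show ?case
    by (intro Ck_on_SucI[of _ _ "\<lambda>x h. frechet_derivative f (at x) h + frechet_derivative g (at x) h"]
        assms(1) has_derivative_add has_derivative_frechet) auto
qed

lemma Ck_on_mult:
  fixes f g :: "_ \<Rightarrow> real"
  assumes "open U" "Ck_on k f U" "Ck_on k g U"
  shows "Ck_on k (\<lambda>x. f x * g x) U"
  using assms(2,3)
proof (induction k arbitrary: f g)
  case 0
  then show ?case by (simp add: continuous_on_mult)
next
  case (Suc k)
  show ?case
  proof (rule Ck_on_SucI[OF assms(1)])
    show "((\<lambda>x. f x * g x) has_derivative
        (\<lambda>h. f x * frechet_derivative g (at x) h + frechet_derivative f (at x) h * g x)) (at x)"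
      if "x \<in> U" for x
      using Suc.prems that by (intro has_derivative_mult has_derivative_frechet) auto
    show "Ck_on k (\<lambda>x. f x * frechet_derivative g (at x) h + frechet_derivative f (at x) h * g x) U"
      for h
      using Suc.prems Ck_on_Suc_imp by (intro Ck_on_add Suc.IH assms(1)) auto
  qed
qed

lemma Ck_on_exp:
  fixes f :: "_ \<Rightarrow> real"
  assumes "open U" "Ck_on k f U"
  shows "Ck_on k (\<lambda>x. exp (f x)) U"
  using assms(2)
proof (induction k)
  case 0
  then show ?case by (simp add: continuous_on_exp)
next
  case (Suc k)
  show ?case
  proof (rule Ck_on_SucI[OF assms(1)])
    show "((\<lambda>x. exp (f x)) has_derivative (\<lambda>h. frechet_derivative f (at x) h * exp (f x))) (at x)"
      if "x \<in> U" for x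
      using Suc.prems that by (intro has_derivative_exp has_derivative_frechet) auto
    show "Ck_on k (\<lambda>x. frechet_derivative f (at x) h * exp (f x)) U" for h
      using Suc Ck_on_Suc_imp by (intro Ck_on_mult assms(1)) auto
  qed
qed

lemma Ck_on_inverse:
  fixes f :: "_ \<Rightarrow> real"
  assumes "open U" "Ck_on k f U" "\<And>x. x \<in> U \<Longrightarrow> f x \<noteq> 0"
  shows "Ck_on k (\<lambda>x. inverse (f x)) U"
  using assms(2)
proof (induction k)
  case 0
  then show ?case using assms(3) by (simp add: continuous_on_inverse)
next
  case (Suc k)
  show ?case
  proof (rule Ck_on_SucI[OF assms(1)])
    show "((\<lambda>x. inverse (f x)) has_derivative
        (\<lambda>h. - (inverse (f x) * frechet_derivative f (at x) h * inverse (f x)))) (at x)"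
      if "x \<in> U" for x
      using Suc.prems that assms(3) by (intro Deriv.has_derivative_inverse has_derivative_frechet) auto
    have "Ck_on k (\<lambda>x. (-1) * (inverse (f x) * frechet_derivative f (at x) h * inverse (f x))) U" for h
      using Suc Ck_on_Suc_imp by (intro Ck_on_mult Ck_on_const assms(1)) auto
    then show "Ck_on k (\<lambda>x. - (inverse (f x) * frechet_derivative f (at x) h * inverse (f x))) U" for h
      by simp
  qed
qed

lemma smooth_on_cong:
  assumes "open U" "\<And>y. y \<in> U \<Longrightarrow> f y = g y" "smooth_on f U"
  shows "smooth_on g U"
  unfolding smooth_on_def
proof
  fix k show "Ck_on k g U"
    using Ck_on_cong[OF assms(1,2)] assms(3) by (simp add: smooth_on_def)
qed

lemma smooth_on_bounded_linear:
  "open U \<Longrightarrow> bounded_linear L \<Longrightarrow> smooth_on f U \<Longrightarrow> smooth_on (\<lambda>x. L (f x)) U"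
  by (simp add: smooth_on_def Ck_on_bounded_linear)

lemma smooth_on_frechet_derivative:
  "smooth_on f U \<Longrightarrow> smooth_on (\<lambda>x. frechet_derivative f (at x) h) U"
  unfolding smooth_on_def by (metis Ck_on.simps(2))

lemma smooth_on_imp_differentiable: "smooth_on f U \<Longrightarrow> x \<in> U \<Longrightarrow> f differentiable (at x)"
  unfolding smooth_on_def by (metis Ck_on.simps(2))

lemma smooth_on_imp_continuous_on: "smooth_on f U \<Longrightarrow> continuous_on U f"
  unfolding smooth_on_def by (metis Ck_on.simps(1))

context
  fixes U :: "'a::real_normed_vector set"
  assumes U: "open U"
begin

lemma smooth_on_const: "smooth_on (\<lambda>x. c) U"
  by (simp add: smooth_on_def Ck_on_const U)

lemma smooth_on_add: "smooth_on f U \<Longrightarrow> smooth_on g U \<Longrightarrow> smooth_on (\<lambda>x. f x + g x) U"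
  by (simp add: smooth_on_def Ck_on_add U)

lemma smooth_on_minus: "smooth_on f U \<Longrightarrow> smooth_on (\<lambda>x. - f x) U"
  by (rule smooth_on_bounded_linear[OF U bounded_linear_minus[OF bounded_linear_ident]])

lemma smooth_on_diff: "smooth_on f U \<Longrightarrow> smooth_on g U \<Longrightarrow> smooth_on (\<lambda>x. f x - g x) U"
  using smooth_on_add[OF _ smooth_on_minus, of f g] by simp

lemma smooth_on_sum:
  "(\<And>i. i \<in> I \<Longrightarrow> smooth_on (f i) U) \<Longrightarrow> smooth_on (\<lambda>x. \<Sum>i\<in>I. f i x) U"
  by (induction I rule: infinite_finite_induct) (simp_all add: smooth_on_const smooth_on_add)

lemma smooth_on_nth: "smooth_on f U \<Longrightarrow> smooth_on (\<lambda>x. f x $ i) U"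
  by (rule smooth_on_bounded_linear[OF U bounded_linear_vec_nth])

context
  fixes f g :: "'a \<Rightarrow> real"
  assumes f: "smooth_on f U"
begin

lemma smooth_on_mult: "smooth_on g U \<Longrightarrow> smooth_on (\<lambda>x. f x * g x) U"
  using f by (simp add: smooth_on_def Ck_on_mult U)

lemma smooth_on_exp: "smooth_on (\<lambda>x. exp (f x)) U"
  using f by (simp add: smooth_on_def Ck_on_exp U)

lemma smooth_on_inverse: "(\<And>x. x \<in> U \<Longrightarrow> f x \<noteq> 0) \<Longrightarrow> smooth_on (\<lambda>x. inverse (f x)) U"
  using f by (simp add: smooth_on_def Ck_on_inverse U)

end

lemma smooth_on_divide:
  fixes f g :: "'a \<Rightarrow> real"
  assumes "smooth_on f U" "smooth_on g U" "\<And>x. x \<in> U \<Longrightarrow> g x \<noteq> 0"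
  shows "smooth_on (\<lambda>x. f x / g x) U"
  using smooth_on_mult[OF assms(1) smooth_on_inverse[OF assms(2,3)]] by (simp add: field_simps)

lemma smooth_on_prod:
  fixes f :: "'i \<Rightarrow> 'a \<Rightarrow> real"
  shows "(\<And>i. i \<in> I \<Longrightarrow> smooth_on (f i) U) \<Longrightarrow> smooth_on (\<lambda>x. \<Prod>i\<in>I. f i x) U"
  by (induction I rule: infinite_finite_induct) (simp_all add: smooth_on_const smooth_on_mult)

lemma smooth_on_det:
  fixes B :: "'a \<Rightarrow> real^'n^'n"
  assumes "\<And>i j. smooth_on (\<lambda>x. B x $ i $ j) U"
  shows "smooth_on (\<lambda>x. det (B x)) U"
  unfolding det_def by (intro smooth_on_sum smooth_on_mult smooth_on_const smooth_on_prod assms)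

end

section \<open>Smooth dependence of the inverse matrix\<close>

lemma matrix_inv_invertible:
  fixes B :: "real^'n^'n"
  assumes "invertible B"
  shows "B ** matrix_inv B = mat 1" "matrix_inv B ** B = mat 1"
proof -
  have "\<exists>C. B ** C = mat 1 \<and> C ** B = mat 1"
    using assms by (simp add: invertible_def)
  then have "B ** matrix_inv B = mat 1 \<and> matrix_inv B ** B = mat 1"
    unfolding matrix_inv_def by (rule someI_ex)
  then show "B ** matrix_inv B = mat 1" "matrix_inv B ** B = mat 1" by auto
qed

text \<open>Cramer's rule for the columns of the unit matrix. It turns the inverse, which is defined
  by choice, into quotients of polynomials in the entries, from which smoothness can be read
  off.\<close>

lemma matrix_inv_cramer:
  fixes B :: "real^'n^'n"
  assumes "invertible B"
  shows "matrix_inv B $ i $ j = det (\<chi> k l. if l = i then mat 1 $ k $ j else B $ k $ l) / det B"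
proof -
  have "B *v column j (matrix_inv B) = column j (mat 1)"
    by (metis assms matrix_inv_invertible(1) matrix_mult_transpose_dot_column matrix_vector_mul_assoc
        matrix_vector_mult_basis)
  then have "column j (matrix_inv B) =
      (\<chi> k. det (\<chi> i l. if l = k then column j (mat 1) $ i else B $ i $ l) / det B)"
    using assms cramer[of B] by (simp add: invertible_det_nz)
  then show ?thesis
    by (simp add: column_def vec_eq_iff cong: if_cong)
qed

lemma smooth_on_matrix_inv:
  fixes B :: "'a::real_normed_vector \<Rightarrow> real^'n^'n"
  assumes U: "open U" and B: "\<And>i j. smooth_on (\<lambda>x. B x $ i $ j) U"
    and inv: "\<And>x. x \<in> U \<Longrightarrow> invertible (B x)"
  shows "smooth_on (\<lambda>x. matrix_inv (B x) $ i $ j) U"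
proof (rule smooth_on_cong[OF U])
  have "smooth_on (\<lambda>x. (\<chi> k l. if l = i then mat 1 $ k $ j else B x $ k $ l) $ a $ b) U" for a b
    using B by (cases "b = i") (auto simp: smooth_on_const[OF U])
  then show "smooth_on (\<lambda>x. det (\<chi> k l. if l = i then mat 1 $ k $ j else B x $ k $ l) / det (B x)) U"
    using inv by (intro smooth_on_divide smooth_on_det U B) (auto simp: invertible_det_nz)
qed (use inv matrix_inv_cramer[of "B _"] in auto)

section \<open>Symmetry of mixed second derivatives\<close>

lemma has_real_derivative_along_line:
  fixes f :: "'a::real_normed_vector \<Rightarrow> real"
  assumes "f differentiable (at (a + r *\<^sub>R h))"
  shows "((\<lambda>r. f (a + r *\<^sub>R h)) has_real_derivative frechet_derivative f (at (a + r *\<^sub>R h)) h) (at r)"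
proof -
  have D: "(f has_derivative frechet_derivative f (at (a + r *\<^sub>R h))) (at (a + r *\<^sub>R h))"
    using assms by (rule has_derivative_frechet)
  have "((\<lambda>r. a + r *\<^sub>R h) has_derivative (\<lambda>e. e *\<^sub>R h)) (at r)"
    by (auto intro!: derivative_eq_intros)
  from diff_chain_at[OF this D] show ?thesis
    unfolding has_field_derivative_def o_def linear_cmul[OF has_derivative_linear[OF D]]
    by (simp add: mult.commute[of _ "frechet_derivative f (at (a + r *\<^sub>R h)) h"])
qed

text \<open>Both iterated derivatives are limits of the second difference quotient
  \<open>(f (x + th + tk) - f (x + th) - f (x + tk) + f x) / t\<^sup>2\<close>; the mean value theorem applied twice
  expresses this quotient through either of them.\<close>

lemma second_difference_mvt:
  fixes f :: "'a::real_normed_vector \<Rightarrow> real"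
  assumes ball: "\<And>r s. 0 \<le> r \<Longrightarrow> r \<le> t \<Longrightarrow> 0 \<le> s \<Longrightarrow> s \<le> t \<Longrightarrow> x + r *\<^sub>R h + s *\<^sub>R k \<in> U"
    and t: "t > 0" and sm: "smooth_on f U"
  shows "\<exists>r s. 0 \<le> r \<and> r \<le> t \<and> 0 \<le> s \<and> s \<le> t \<and>
    f (x + t *\<^sub>R h + t *\<^sub>R k) - f (x + t *\<^sub>R h) - f (x + t *\<^sub>R k) + f x =
    t * t * frechet_derivative (\<lambda>y. frechet_derivative f (at y) h) (at (x + r *\<^sub>R h + s *\<^sub>R k)) k"
proof -
  have curve2: "((\<lambda>s. F (x + r *\<^sub>R h + s *\<^sub>R k)) has_real_derivative
      frechet_derivative F (at (x + r *\<^sub>R h + s *\<^sub>R k)) k) (at s)"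
    if "smooth_on F U" "x + r *\<^sub>R h + s *\<^sub>R k \<in> U" for F :: "'a \<Rightarrow> real" and r s
    using that(2) by (intro has_real_derivative_along_line smooth_on_imp_differentiable[OF that(1)])
  have curve1: "((\<lambda>r. F (x + r *\<^sub>R h + s *\<^sub>R k)) has_real_derivative
      frechet_derivative F (at (x + r *\<^sub>R h + s *\<^sub>R k)) h) (at r)"
    if "smooth_on F U" "x + r *\<^sub>R h + s *\<^sub>R k \<in> U" for F :: "'a \<Rightarrow> real" and r s
  proof -
    have "x + s *\<^sub>R k + r *\<^sub>R h \<in> U" using that(2) by (simp add: add_ac)
    from has_real_derivative_along_line[OF smooth_on_imp_differentiable[OF that(1) this]]
    show ?thesis by (simp add: add_ac)
  qed
  \<comment> \<open>The difference in direction \<open>k\<close>, as a function of the parameter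
    along \<open>h\<close>. The summand with factor 0 gives both terms the shape of
    \<open>curve1\<close>.\<close>
  define G where "G r = f (x + r *\<^sub>R h + t *\<^sub>R k) - f (x + r *\<^sub>R h + 0 *\<^sub>R k)" for r
  define Df where "Df y = frechet_derivative f (at y) h" for y
  have Dsm: "smooth_on Df U"
    unfolding Df_def by (rule smooth_on_frechet_derivative[OF sm])
  have "(G has_real_derivative Df (x + r *\<^sub>R h + t *\<^sub>R k) - Df (x + r *\<^sub>R h + 0 *\<^sub>R k)) (at r)"
    if "0 \<le> r" "r \<le> t" for r
    unfolding G_def Df_def using ball[of r t] ball[of r 0] that t by (intro derivative_intros curve1 sm) auto
  from MVT2[OF t this] obtain r where r: "0 < r" "r < t"
    and Gr: "G t - G 0 = (t - 0) * (Df (x + r *\<^sub>R h + t *\<^sub>R k) - Df (x + r *\<^sub>R h + 0 *\<^sub>R k))"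
    by blast
  have "((\<lambda>s. Df (x + r *\<^sub>R h + s *\<^sub>R k)) has_real_derivative
      frechet_derivative Df (at (x + r *\<^sub>R h + s *\<^sub>R k)) k) (at s)"
    if "0 \<le> s" "s \<le> t" for s
    using ball[of r s] that t r by (intro curve2 Dsm) auto
  from MVT2[OF t this] obtain s where s: "0 < s" "s < t" and
    "Df (x + r *\<^sub>R h + t *\<^sub>R k) - Df (x + r *\<^sub>R h + 0 *\<^sub>R k) =
     (t - 0) * frechet_derivative Df (at (x + r *\<^sub>R h + s *\<^sub>R k)) k"
    by blast
  then have "G t - G 0 = t * t * frechet_derivative Df (at (x + r *\<^sub>R h + s *\<^sub>R k)) k"
    using Gr by simp
  then show ?thesis
    using r s unfolding G_def Df_def by (intro exI[of _ r] exI[of _ s]) (auto simp: algebra_simps)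
qed

lemma frechet_derivative_commute:
  fixes f :: "'a::real_normed_vector \<Rightarrow> real"
  assumes U: "open U" and x: "x \<in> U" and sm: "smooth_on f U"
  shows "frechet_derivative (\<lambda>y. frechet_derivative f (at y) h) (at x) k =
         frechet_derivative (\<lambda>y. frechet_derivative f (at y) k) (at x) h"
proof -
  define P where "P h k y = frechet_derivative (\<lambda>y. frechet_derivative f (at y) h) (at y) k" for h k y
  have cont: "isCont (P h k) x" for h k
    unfolding P_def
    using smooth_on_imp_continuous_on[OF smooth_on_frechet_derivative[OF smooth_on_frechet_derivative[OF sm]]]
      U x continuous_on_eq_continuous_at by blast
  have "\<bar>P h k x - P k h x\<bar> \<le> e" if e: "e > 0" for e
  proof -
    obtain d1 where d1: "d1 > 0" "\<And>y. dist y x < d1 \<Longrightarrow> dist (P h k y) (P h k x) < e/2"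
      using cont[of h k] e half_gt_zero[OF e] unfolding continuous_at_eps_delta by blast
    obtain d2 where d2: "d2 > 0" "\<And>y. dist y x < d2 \<Longrightarrow> dist (P k h y) (P k h x) < e/2"
      using cont[of k h] e half_gt_zero[OF e] unfolding continuous_at_eps_delta by blast
    obtain d3 where d3: "d3 > 0" "\<And>y. dist y x < d3 \<Longrightarrow> y \<in> U"
      using U x unfolding open_dist by blast
    define d where "d = min d1 (min d2 d3)"
    \<comment> \<open>Small enough for the whole parallelogram spanned by \<open>t h\<close> and
      \<open>t k\<close> to lie within \<open>d / 2\<close> of \<open>x\<close>; the added 1 keeps
      the denominator positive when \<open>h\<close> and \<open>k\<close> vanish.\<close>
    define t where "t = d / (2 * (norm h + norm k + 1))"
    have d: "d > 0" using d1 d2 d3 by (simp add: d_def)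
    have n: "norm h + norm k + 1 > 0" by (smt (verit) norm_ge_zero)
    then have t: "t > 0" using d by (simp add: t_def)
    have near: "dist (x + r *\<^sub>R h + s *\<^sub>R k) x < d" if "0 \<le> r" "r \<le> t" "0 \<le> s" "s \<le> t" for r s
    proof -
      have "dist (x + r *\<^sub>R h + s *\<^sub>R k) x = norm (r *\<^sub>R h + s *\<^sub>R k)"
        by (simp add: dist_norm algebra_simps)
      also have "\<dots> \<le> r * norm h + s * norm k"
        using that by (intro order_trans[OF norm_triangle_ineq]) simp
      also have "\<dots> \<le> t * norm h + t * norm k"
        using that by (intro add_mono mult_right_mono) auto
      also have "\<dots> \<le> t * (norm h + norm k + 1)" using t by (simp add: algebra_simps)
      also have "\<dots> = d / 2" using n by (simp add: t_def field_simps)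
      finally show ?thesis using d by simp
    qed
    obtain r s where rs: "0 \<le> r" "r \<le> t" "0 \<le> s" "s \<le> t"
      "f (x + t *\<^sub>R h + t *\<^sub>R k) - f (x + t *\<^sub>R h) - f (x + t *\<^sub>R k) + f x =
        t * t * P h k (x + r *\<^sub>R h + s *\<^sub>R k)"
    proof -
      have "x + r *\<^sub>R h + s *\<^sub>R k \<in> U" if "0 \<le> r" "r \<le> t" "0 \<le> s" "s \<le> t" for r s
        using near[OF that] d3 by (simp add: d_def)
      from second_difference_mvt[of t x h k U f, OF this t sm] show ?thesis
        using that unfolding P_def by blast
    qed
    obtain r' s' where rs': "0 \<le> r'" "r' \<le> t" "0 \<le> s'" "s' \<le> t"
      "f (x + t *\<^sub>R k + t *\<^sub>R h) - f (x + t *\<^sub>R k) - f (x + t *\<^sub>R h) + f x =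
        t * t * P k h (x + r' *\<^sub>R k + s' *\<^sub>R h)"
    proof -
      have "x + r *\<^sub>R k + s *\<^sub>R h \<in> U" if "0 \<le> r" "r \<le> t" "0 \<le> s" "s \<le> t" for r s
        using near[OF that(3,4,1,2)] d3 by (simp add: d_def add.assoc add.commute[of "r *\<^sub>R k"])
      from second_difference_mvt[of t x k h U f, OF this t sm] show ?thesis
        using that unfolding P_def by blast
    qed
    \<comment> \<open>Both second differences are the same number, so the two mixed derivatives
      agree, though at two different points near \<open>x\<close>; continuity then bounds their
      difference at \<open>x\<close>.\<close>
    have "t * t * P h k (x + r *\<^sub>R h + s *\<^sub>R k) = t * t * P k h (x + r' *\<^sub>R k + s' *\<^sub>R h)"
      using rs(5) rs'(5) by (simp add: algebra_simps)
    then have "P h k (x + r *\<^sub>R h + s *\<^sub>R k) = P k h (x + s' *\<^sub>R h + r' *\<^sub>R k)"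
      using t by (simp add: algebra_simps)
    moreover have "dist (P h k (x + r *\<^sub>R h + s *\<^sub>R k)) (P h k x) < e/2"
      using near[OF rs(1-4)] d1 by (simp add: d_def)
    moreover have "dist (P k h (x + s' *\<^sub>R h + r' *\<^sub>R k)) (P k h x) < e/2"
      using near[OF rs'(3,4,1,2)] d2 by (simp add: d_def)
    ultimately show ?thesis unfolding dist_real_def by linarith
  qed
  then have "\<bar>P h k x - P k h x\<bar> \<le> 0"
    by (rule field_le_epsilon) simp
  then have "P h k x = P k h x" by simp
  then show ?thesis by (simp add: P_def)
qed

section \<open>Partial derivatives in coordinates\<close>

lemma smooth_on_pderiv_vec: "smooth_on f U \<Longrightarrow> smooth_on (pderiv_vec i f) U"
  unfolding pderiv_vec_def[abs_def] by (rule smooth_on_frechet_derivative)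

lemma pderiv_vec_commute:
  "open U \<Longrightarrow> x \<in> U \<Longrightarrow> smooth_on f U \<Longrightarrow>
    pderiv_vec i (pderiv_vec j f) x = pderiv_vec j (pderiv_vec i f) x"
  unfolding pderiv_vec_def[abs_def] by (rule frechet_derivative_commute)

lemma pderiv_vec_const: "pderiv_vec i (\<lambda>x. c) x = 0"
  by (simp add: pderiv_vec_def)

lemma has_derivative_smooth_on:
  "x \<in> U \<Longrightarrow> smooth_on f U \<Longrightarrow> (f has_derivative frechet_derivative f (at x)) (at x)"
  by (intro has_derivative_frechet smooth_on_imp_differentiable)

lemma pderiv_vec_eq: "(f has_derivative D) (at x) \<Longrightarrow> pderiv_vec i f x = D (axis i 1)"
  by (metis frechet_derivative_at pderiv_vec_def)

lemma pderiv_vec_add: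
  "x \<in> U \<Longrightarrow> smooth_on f U \<Longrightarrow> smooth_on g U \<Longrightarrow>
    pderiv_vec i (\<lambda>x. f x + g x) x = pderiv_vec i f x + pderiv_vec i g x"
  by (rule pderiv_vec_eq[OF has_derivative_add[OF has_derivative_smooth_on has_derivative_smooth_on],
      folded pderiv_vec_def])

lemma pderiv_vec_diff:
  "x \<in> U \<Longrightarrow> smooth_on f U \<Longrightarrow> smooth_on g U \<Longrightarrow>
    pderiv_vec i (\<lambda>x. f x - g x) x = pderiv_vec i f x - pderiv_vec i g x"
  by (rule pderiv_vec_eq[OF has_derivative_diff[OF has_derivative_smooth_on has_derivative_smooth_on],
      folded pderiv_vec_def])

lemma pderiv_vec_minus:
  "x \<in> U \<Longrightarrow> smooth_on f U \<Longrightarrow> pderiv_vec i (\<lambda>x. - f x) x = - pderiv_vec i f x"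
  by (rule pderiv_vec_eq[OF has_derivative_minus[OF has_derivative_smooth_on], folded pderiv_vec_def])

lemma pderiv_vec_mult:
  "x \<in> U \<Longrightarrow> smooth_on f U \<Longrightarrow> smooth_on g U \<Longrightarrow>
    pderiv_vec i (\<lambda>x. f x * g x) x = f x * pderiv_vec i g x + pderiv_vec i f x * g x"
  by (rule pderiv_vec_eq[OF has_derivative_mult[OF has_derivative_smooth_on has_derivative_smooth_on],
      folded pderiv_vec_def])

lemma pderiv_vec_exp:
  "x \<in> U \<Longrightarrow> smooth_on f U \<Longrightarrow> pderiv_vec i (\<lambda>x. exp (f x)) x = pderiv_vec i f x * exp (f x)"
  by (rule pderiv_vec_eq[OF has_derivative_exp[OF has_derivative_smooth_on], folded pderiv_vec_def])

lemma pderiv_vec_sum: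
  assumes "open U" "x \<in> U" "\<And>i. i \<in> I \<Longrightarrow> smooth_on (f i) U"
  shows "pderiv_vec k (\<lambda>x. \<Sum>i\<in>I. f i x) x = (\<Sum>i\<in>I. pderiv_vec k (f i) x)"
  using assms(3)
proof (induction I rule: infinite_finite_induct)
  case (insert i I)
  then show ?case
    using assms(1,2) by (simp add: pderiv_vec_add[of x U] smooth_on_sum)
qed (simp_all add: pderiv_vec_const)


section \<open>Curvature in local coordinates\<close>

locale metric_domain =
  fixes U :: "(real^'n) set" and g :: "real^'n \<Rightarrow> real^'n^'n"
  assumes open_U: "open U"
    and smooth_g: "smooth_on (\<lambda>x. g x $ i $ j) U"
    and g_sym: "x \<in> U \<Longrightarrow> g x $ i $ j = g x $ j $ i"
    and g_invertible: "x \<in> U \<Longrightarrow> invertible (g x)"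
begin

lemmas smooth_rules = smooth_on_const[OF open_U] smooth_on_add[OF open_U] smooth_on_minus[OF open_U]
  smooth_on_diff[OF open_U] smooth_on_mult[OF open_U] smooth_on_sum[OF open_U] smooth_on_pderiv_vec
  smooth_g

lemmas pderiv_rules = pderiv_vec_const pderiv_vec_add[of _ U] pderiv_vec_minus[of _ U]
  pderiv_vec_diff[of _ U] pderiv_vec_mult[of _ U] pderiv_vec_sum[OF open_U]

lemmas pderiv_cong = pderiv_vec_cong[OF open_U]

lemma smooth_g_inv: "smooth_on (\<lambda>x. matrix_inv (g x) $ i $ j) U"
  by (rule smooth_on_matrix_inv[OF open_U smooth_g g_invertible])

lemma smooth_christoffel: "smooth_on (christoffel g l i j) U"
  unfolding christoffel_def[abs_def] by (intro smooth_rules smooth_g_inv)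

lemma smooth_riemann: "smooth_on (riemann g l k i j) U"
  unfolding riemann_def[abs_def] by (intro smooth_rules smooth_christoffel)

lemma smooth_ricci: "smooth_on (ricci g j k) U"
  unfolding ricci_def[abs_def] by (intro smooth_rules smooth_riemann)

lemma smooth_scalar_curv: "smooth_on (scalar_curv g) U"
  unfolding scalar_curv_def[abs_def] by (intro smooth_rules smooth_g_inv smooth_ricci)

lemma christoffel_sym: "x \<in> U \<Longrightarrow> christoffel g k i j x = christoffel g k j i x"
  by (rule christoffel_torsion_free[OF open_U _ g_sym])

lemma pderiv_christoffel_sym:
  "x \<in> U \<Longrightarrow> pderiv_vec l (christoffel g k i j) x = pderiv_vec l (christoffel g k j i) x"
  by (rule pderiv_cong) (auto intro: christoffel_sym)

lemma pderiv_g: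
  "x \<in> U \<Longrightarrow> pderiv_vec i (\<lambda>y. g y $ j $ k) x =
    (\<Sum>m\<in>UNIV. christoffel g m i j x * g x $ m $ k) + (\<Sum>m\<in>UNIV. christoffel g m i k x * g x $ j $ m)"
  by (rule christoffel_metric_compatible[OF open_U _ g_sym g_invertible])

lemma g_inv_g: "x \<in> U \<Longrightarrow> (\<Sum>l\<in>UNIV. matrix_inv (g x) $ i $ l * g x $ l $ j) = (if i = j then 1 else 0)"
  using arg_cong[OF matrix_inv_invertible(2)[OF g_invertible], of x "\<lambda>B. B $ i $ j"]
  by (simp add: matrix_matrix_mult_def mat_def)

lemma g_g_inv: "x \<in> U \<Longrightarrow> (\<Sum>l\<in>UNIV. g x $ i $ l * matrix_inv (g x) $ l $ j) = (if i = j then 1 else 0)"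
  using arg_cong[OF matrix_inv_invertible(1)[OF g_invertible], of x "\<lambda>B. B $ i $ j"]
  by (simp add: matrix_matrix_mult_def mat_def)

lemma raise_lower:
  "x \<in> U \<Longrightarrow> (\<Sum>l\<in>UNIV. matrix_inv (g x) $ i $ l * (\<Sum>m\<in>UNIV. g x $ l $ m * v m)) = v i"
proof -
  assume x: "x \<in> U"
  have "(\<Sum>l\<in>UNIV. matrix_inv (g x) $ i $ l * (\<Sum>m\<in>UNIV. g x $ l $ m * v m)) =
      (\<Sum>m\<in>UNIV. (\<Sum>l\<in>UNIV. matrix_inv (g x) $ i $ l * g x $ l $ m) * v m)"
    by (simp only: sum_distrib_left sum_distrib_right mult.assoc) (rule sum.swap)
  then show ?thesis
    using x by (simp add: g_inv_g if_distrib[of "\<lambda>z. z * _"] cong: if_cong)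
qed

lemma lower_raise:
  "x \<in> U \<Longrightarrow> (\<Sum>l\<in>UNIV. g x $ i $ l * (\<Sum>m\<in>UNIV. matrix_inv (g x) $ l $ m * v m)) = v i"
proof -
  assume x: "x \<in> U"
  have "(\<Sum>l\<in>UNIV. g x $ i $ l * (\<Sum>m\<in>UNIV. matrix_inv (g x) $ l $ m * v m)) =
      (\<Sum>m\<in>UNIV. (\<Sum>l\<in>UNIV. g x $ i $ l * matrix_inv (g x) $ l $ m) * v m)"
    by (simp only: sum_distrib_left sum_distrib_right mult.assoc) (rule sum.swap)
  then show ?thesis
    using x by (simp add: g_g_inv if_distrib[of "\<lambda>z. z * _"] cong: if_cong)
qed

section \<open>Curvature identities and commuting covariant derivatives\<close>

lemma riemann_antisym: "riemann g l k i j x = - riemann g l k j i x"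
  by (simp add: riemann_def sum_subtractf)

text \<open>Torsion-freeness: once lower indices of the Christoffel symbols are exchanged, the terms
  of the cyclic sum cancel in pairs.\<close>

lemma bianchi_first:
  "x \<in> U \<Longrightarrow> riemann g l k i j x + riemann g l i j k x + riemann g l j k i x = 0"
proof -
  assume x: "x \<in> U"
  show ?thesis
    unfolding riemann_def
    by (simp add: sum_subtractf christoffel_sym[OF x, of _ k] christoffel_sym[OF x, of _ j i]
        pderiv_christoffel_sym[OF x, of _ _ k] pderiv_christoffel_sym[OF x, of _ _ j i])
qed

text \<open>\<open>cov1 \<alpha> j k\<close> is \<open>(\<nabla>\<^sub>j \<alpha>)\<^sub>k\<close>.\<close>

definition cov1 :: "('n \<Rightarrow> real^'n \<Rightarrow> real) \<Rightarrow> 'n \<Rightarrow> 'n \<Rightarrow> real^'n \<Rightarrow> real" where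
  "cov1 \<alpha> j k x = pderiv_vec j (\<alpha> k) x - (\<Sum>m\<in>UNIV. christoffel g m j k x * \<alpha> m x)"

lemma smooth_cov1: "(\<And>k. smooth_on (\<alpha> k) U) \<Longrightarrow> smooth_on (cov1 \<alpha> j k) U"
  unfolding cov1_def[abs_def] by (intro smooth_rules smooth_christoffel)

text \<open>The left side is the full commutator of second covariant derivatives: the connection
  term for the differentiation index \<open>j\<close> is symmetric in \<open>i\<close>,
  \<open>j\<close> and drops out of the difference.\<close>

lemma ricci_identity:
  assumes x: "x \<in> U" and \<alpha>: "\<And>k. smooth_on (\<alpha> k) U"
  shows "(pderiv_vec i (cov1 \<alpha> j k) x - (\<Sum>m\<in>UNIV. christoffel g m i k x * cov1 \<alpha> j m x))
       - (pderiv_vec j (cov1 \<alpha> i k) x - (\<Sum>m\<in>UNIV. christoffel g m j k x * cov1 \<alpha> i m x))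
       = - (\<Sum>l\<in>UNIV. riemann g l k i j x * \<alpha> l x)"
proof -
  have d: "pderiv_vec i (cov1 \<alpha> j k) x = pderiv_vec i (pderiv_vec j (\<alpha> k)) x -
      (\<Sum>m\<in>UNIV. christoffel g m j k x * pderiv_vec i (\<alpha> m) x
        + pderiv_vec i (christoffel g m j k) x * \<alpha> m x)" for i j
    unfolding cov1_def[abs_def]
    by (simp add: x \<alpha> pderiv_rules smooth_rules smooth_christoffel)
  have s: "(\<Sum>m\<in>UNIV. \<Sum>n\<in>UNIV. christoffel g m i k x * christoffel g n j m x * \<alpha> n x) =
     (\<Sum>n\<in>UNIV. \<Sum>m\<in>UNIV. christoffel g n j m x * christoffel g m i k x * \<alpha> n x)" for i j
    by (subst sum.swap) (simp add: mult_ac)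
  show ?thesis
    unfolding d unfolding cov1_def riemann_def
    using s[of i j] s[of j i] pderiv_vec_commute[OF open_U x \<alpha>, of i j k]
    by (simp add: sum.distrib sum_subtractf sum_distrib_left sum_distrib_right algebra_simps sum_negf)
qed


text \<open>The integrability condition of the first-order system that defines a parallel field:
  differentiate it once more and use that partial derivatives commute.\<close>

lemma riemann_parallel:
  assumes x: "x \<in> U" and Y: "\<And>k. smooth_on (\<lambda>y. Y y $ k) U"
    and par: "\<And>y i k. y \<in> U \<Longrightarrow> covariant_deriv_vec g Y i k y = 0"
  shows "(\<Sum>k\<in>UNIV. riemann g l k i j x * Y x $ k) = 0"
proof -
  have dY: "pderiv_vec j (\<lambda>y. Y y $ l) y = - (\<Sum>k\<in>UNIV. christoffel g l j k y * Y y $ k)"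
    if "y \<in> U" for y j l
    using par[OF that, of j l] by (simp add: covariant_deriv_vec_def)
  have d: "pderiv_vec i (pderiv_vec j (\<lambda>y. Y y $ l)) x =
      - (\<Sum>k\<in>UNIV. christoffel g l j k x * - (\<Sum>m\<in>UNIV. christoffel g k i m x * Y x $ m)
         + pderiv_vec i (christoffel g l j k) x * Y x $ k)" for i j
  proof -
    have "pderiv_vec i (pderiv_vec j (\<lambda>y. Y y $ l)) x =
        pderiv_vec i (\<lambda>y. - (\<Sum>k\<in>UNIV. christoffel g l j k y * Y y $ k)) x"
      by (rule pderiv_cong[OF x dY])
    then show ?thesis
      by (simp add: x Y pderiv_rules smooth_rules smooth_christoffel dY)
  qed
  have s: "(\<Sum>k\<in>UNIV. \<Sum>m\<in>UNIV. christoffel g l j k x * christoffel g k i m x * Y x $ m) =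
     (\<Sum>m\<in>UNIV. \<Sum>k\<in>UNIV. christoffel g l j k x * christoffel g k i m x * Y x $ m)" for i j
    by (rule sum.swap)
  show ?thesis
    using pderiv_vec_commute[OF open_U x Y, of i j l] s[of i j] s[of j i] unfolding d riemann_def
    by (simp add: sum.distrib sum_subtractf sum_distrib_left sum_distrib_right algebra_simps sum_negf)
qed

text \<open>The index convention is \<open>R\<^sub>l\<^sub>k\<^sub>i\<^sub>j = \<langle>R(\<partial>\<^sub>i,\<partial>\<^sub>j)\<partial>\<^sub>k, \<partial>\<^sub>l\<rangle>\<close>.\<close>

definition riemann_low :: "'n \<Rightarrow> 'n \<Rightarrow> 'n \<Rightarrow> 'n \<Rightarrow> real^'n \<Rightarrow> real" where
  "riemann_low l k i j x = (\<Sum>m\<in>UNIV. g x $ l $ m * riemann g m k i j x)"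

lemma riemann_raise:
  "x \<in> U \<Longrightarrow> riemann g l k i j x = (\<Sum>p\<in>UNIV. matrix_inv (g x) $ l $ p * riemann_low p k i j x)"
  by (simp add: riemann_low_def raise_lower)

lemma riemann_low_antisym_right: "riemann_low l k i j x = - riemann_low l k j i x"
  unfolding riemann_low_def by (simp add: riemann_antisym[of _ _ i j] sum_negf)

text \<open>Metric compatibility, differentiated once more, expresses the second derivatives of
  \<open>g\<close> through the connection; their symmetry is the claim.\<close>

lemma riemann_low_antisym_left:
  assumes x: "x \<in> U"
  shows "riemann_low l k i j x = - riemann_low k l i j x"
proof -
  define C where "C = (\<lambda>l i j. christoffel g l i j x)"
  define dC where "dC = (\<lambda>i l j k. pderiv_vec i (christoffel g l j k) x)"
  have d: "pderiv_vec i (pderiv_vec j (\<lambda>y. g y $ k $ l)) x =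
     (\<Sum>m\<in>UNIV. C m j k * ((\<Sum>n\<in>UNIV. C n i m * g x $ n $ l) + (\<Sum>n\<in>UNIV. C n i l * g x $ m $ n))
        + dC i m j k * g x $ m $ l) +
     (\<Sum>m\<in>UNIV. C m j l * ((\<Sum>n\<in>UNIV. C n i k * g x $ n $ m) + (\<Sum>n\<in>UNIV. C n i m * g x $ k $ n))
        + dC i m j l * g x $ k $ m)"
    for i j
  proof -
    have "pderiv_vec i (pderiv_vec j (\<lambda>y. g y $ k $ l)) x =
        pderiv_vec i (\<lambda>y. (\<Sum>m\<in>UNIV. christoffel g m j k y * g y $ m $ l) +
          (\<Sum>m\<in>UNIV. christoffel g m j l y * g y $ k $ m)) x"
      by (rule pderiv_cong[OF x pderiv_g])
    then show ?thesis
      by (simp add: x pderiv_rules smooth_rules smooth_christoffel pderiv_g C_def dC_def)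
  qed
  have s1: "(\<Sum>m\<in>UNIV. \<Sum>n\<in>UNIV. C m a k' * C n b m * g x $ n $ l') =
      (\<Sum>n\<in>UNIV. \<Sum>m\<in>UNIV. g x $ l' $ n * (C n b m * C m a k'))" for a b k' l'
    by (subst sum.swap) (simp add: g_sym[OF x, of _ l'] mult_ac)
  have s2: "(\<Sum>m\<in>UNIV. \<Sum>n\<in>UNIV. C m a l' * C n b k' * g x $ n $ m) =
      (\<Sum>m\<in>UNIV. \<Sum>n\<in>UNIV. C m b k' * C n a l' * g x $ m $ n)" for a b k' l'
    by (subst sum.swap) (simp add: mult_ac)
  have r: "riemann_low l' k' a b x = (\<Sum>m\<in>UNIV. g x $ l' $ m * dC a m b k')
      - (\<Sum>m\<in>UNIV. g x $ l' $ m * dC b m a k')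
      + (\<Sum>n\<in>UNIV. \<Sum>m\<in>UNIV. g x $ l' $ n * (C n a m * C m b k'))
      - (\<Sum>n\<in>UNIV. \<Sum>m\<in>UNIV. g x $ l' $ n * (C n b m * C m a k'))" for a b k' l'
    unfolding riemann_low_def riemann_def C_def dC_def
    by (simp add: sum.distrib sum_subtractf sum_distrib_left algebra_simps)
  \<comment> \<open>The last two sums change places under \<open>i\<close> and \<open>j\<close>
    being exchanged, so they cancel in the commutator. The other four add up to the two lowered
    curvature terms.\<close>
  have t: "pderiv_vec i (pderiv_vec j (\<lambda>y. g y $ k $ l)) x =
     (\<Sum>m\<in>UNIV. g x $ l $ m * dC i m j k) + (\<Sum>m\<in>UNIV. g x $ k $ m * dC i m j l)
     + (\<Sum>n\<in>UNIV. \<Sum>m\<in>UNIV. g x $ l $ n * (C n i m * C m j k))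
     + (\<Sum>n\<in>UNIV. \<Sum>m\<in>UNIV. g x $ k $ n * (C n i m * C m j l))
     + (\<Sum>m\<in>UNIV. \<Sum>n\<in>UNIV. C m j k * C n i l * g x $ m $ n)
     + (\<Sum>m\<in>UNIV. \<Sum>n\<in>UNIV. C m i k * C n j l * g x $ m $ n)" for i j
    unfolding d s1[symmetric] s2[of j l i k, symmetric]
    by (simp add: sum.distrib sum_distrib_left algebra_simps g_sym[OF x, of k] g_sym[OF x, of _ l])
  show ?thesis
    using pderiv_vec_commute[OF open_U x smooth_g, of i j k l] unfolding t r
    by (simp add: algebra_simps)
qed

end


section \<open>Parallel vector fields\<close>

context metric_domain
begin

text \<open>Take the first Bianchi identity with first index \<open>l\<close>, \<open>k\<close>,
  \<open>i\<close>, \<open>j\<close> and signs +, -, -, +. By the antisymmetries everything cancels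
  except twice the difference of the two sides.\<close>

lemma riemann_low_pair_sym:
  assumes x: "x \<in> U"
  shows "riemann_low l k i j x = riemann_low i j l k x"
proof -
  have b: "riemann_low p q r s x + riemann_low p r s q x + riemann_low p s q r x = 0" for p q r s
    unfolding riemann_low_def
    using bianchi_first[OF x, of _ q r s]
    by (simp add: sum.distrib[symmetric] distrib_left[symmetric])
  note al = riemann_low_antisym_left[OF x] and ar = riemann_low_antisym_right[of _ _ _ _ x]
  show ?thesis
    using b[of l k i j] b[of k i j l] b[of i j l k] b[of j l k i]
      al[of k l i j] ar[of k l i j] ar[of l k j i] al[of k i j l] ar[of k i j l] al[of i k l j]
      ar[of i j l k] al[of j i l k] al[of j l k i] ar[of j l k i] ar[of l j i k] al[of l j i k]
      ar[of l i j k] al[of l i j k] al[of l i k j] ar[of i l j k] al[of j k i l] ar[of j k i l]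
      ar[of k j l i] al[of k j l i] al[of i k j l] ar[of i k j l] ar[of k i l j] al[of j i k l]
      ar[of j i k l]
    by linarith
qed

text \<open>\<open>cov_riemann i l m j k\<close> is the covariant derivative along \<open>\<partial>\<^sub>i\<close> of the endomorphism
  \<open>R(\<partial>\<^sub>j,\<partial>\<^sub>k)\<close>; the form indices \<open>j, k\<close> are not differentiated covariantly, which makes no
  difference to the cyclic sum.\<close>

definition cov_riemann :: "'n \<Rightarrow> 'n \<Rightarrow> 'n \<Rightarrow> 'n \<Rightarrow> 'n \<Rightarrow> real^'n \<Rightarrow> real" where
  "cov_riemann i l m j k x = pderiv_vec i (riemann g l m j k) x
     + (\<Sum>n\<in>UNIV. christoffel g l i n x * riemann g n m j k x)
     - (\<Sum>n\<in>UNIV. christoffel g n i m x * riemann g l n j k x)"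

text \<open>In the cyclic sum the second derivatives of the Christoffel symbols cancel because
  partial derivatives commute, and the lower-order terms cancel in pairs.\<close>

lemma bianchi_second:
  assumes x: "x \<in> U"
  shows "cov_riemann i l m j k x + cov_riemann j l m k i x + cov_riemann k l m i j x = 0"
proof -
  define C where "C = (\<lambda>l i j. christoffel g l i j x)"
  define dC where "dC = (\<lambda>i l j k. pderiv_vec i (christoffel g l j k) x)"
  define ddC where "ddC = (\<lambda>h i l j k. pderiv_vec h (pderiv_vec i (christoffel g l j k)) x)"
  \<comment> \<open>Every cubic term is a value of \<open>T\<close> at a permutation of
    \<open>i\<close>, \<open>j\<close>, \<open>k\<close>, so their cancellation becomes visible to
    the simplifier.\<close>
  define T where "T a b c = (\<Sum>n\<in>UNIV. \<Sum>p\<in>UNIV. C l a n * (C n b p * C p c m))" for a b c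
  have comm: "ddC a b l j k = ddC b a l j k" for a b l j k
    unfolding ddC_def by (rule pderiv_vec_commute[OF open_U x smooth_christoffel])
  have dR: "pderiv_vec a (riemann g l m b c) x = ddC a b l c m - ddC a c l b m
      + (\<Sum>n\<in>UNIV. C l b n * dC a n c m) + (\<Sum>n\<in>UNIV. C n c m * dC a l b n)
      - (\<Sum>n\<in>UNIV. C l c n * dC a n b m) - (\<Sum>n\<in>UNIV. C n b m * dC a l c n)" for a b c
    unfolding riemann_def[abs_def] C_def dC_def ddC_def
    by (simp add: x pderiv_rules smooth_rules smooth_christoffel sum.distrib sum_subtractf mult.commute
        algebra_simps)
  have 1: "(\<Sum>n\<in>UNIV. christoffel g l a n x * riemann g n m b c x) =
      (\<Sum>n\<in>UNIV. C l a n * dC b n c m) - (\<Sum>n\<in>UNIV. C l a n * dC c n b m) + T a b c - T a c b" for a b c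
    unfolding riemann_def T_def C_def dC_def
    by (simp add: sum.distrib sum_subtractf sum_distrib_left algebra_simps)
  have s: "(\<Sum>n\<in>UNIV. \<Sum>p\<in>UNIV. C n a m * (C l b p * C p c n)) = T b c a" for a b c
    unfolding T_def by (subst sum.swap) (simp add: mult_ac)
  have 2: "(\<Sum>n\<in>UNIV. christoffel g n a m x * riemann g l n b c x) =
      (\<Sum>n\<in>UNIV. C n a m * dC b l c n) - (\<Sum>n\<in>UNIV. C n a m * dC c l b n) + T b c a - T c b a" for a b c
    unfolding s[symmetric] riemann_def C_def dC_def
    by (simp add: sum.distrib sum_subtractf sum_distrib_left algebra_simps)
  show ?thesis
    unfolding cov_riemann_def dR 1 2
    using comm[of i j] comm[of j k] comm[of i k] by simp
qed

end

locale parallel_field = metric_domain U g for U :: "(real^'n) set" and g +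
  fixes Y :: "real^'n \<Rightarrow> real^'n"
  assumes smooth_Y: "smooth_on (\<lambda>y. Y y $ k) U"
    and parallel_Y: "x \<in> U \<Longrightarrow> covariant_deriv_vec g Y i k x = 0"
    and Y_norm_nonzero: "x \<in> U \<Longrightarrow> (\<Sum>k\<in>UNIV. (\<Sum>m\<in>UNIV. g x $ k $ m * Y x $ m) * Y x $ k) \<noteq> 0"
begin

definition Y_low :: "'n \<Rightarrow> real^'n \<Rightarrow> real" where
  "Y_low k x = (\<Sum>m\<in>UNIV. g x $ k $ m * Y x $ m)"

definition Y_sq :: "real^'n \<Rightarrow> real" where
  "Y_sq x = (\<Sum>k\<in>UNIV. Y_low k x * Y x $ k)"

lemma Y_sq_nonzero: "x \<in> U \<Longrightarrow> Y_sq x \<noteq> 0"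
  using Y_norm_nonzero by (simp add: Y_sq_def Y_low_def)

lemma smooth_Y_low: "smooth_on (Y_low k) U"
  unfolding Y_low_def[abs_def] by (intro smooth_rules smooth_Y)

lemma smooth_Y_sq: "smooth_on Y_sq U"
  unfolding Y_sq_def[abs_def] by (intro smooth_rules smooth_Y smooth_Y_low)

lemma pderiv_Y:
  "x \<in> U \<Longrightarrow> pderiv_vec j (\<lambda>y. Y y $ l) x = - (\<Sum>k\<in>UNIV. christoffel g l j k x * Y x $ k)"
  using parallel_Y[of x j l] by (simp add: covariant_deriv_vec_def)

text \<open>The dual one-form is parallel as well: of the two terms of metric compatibility, one
  cancels against the derivative of \<open>Y\<close>.\<close>

lemma pderiv_Y_low:
  assumes x: "x \<in> U"
  shows "pderiv_vec i (Y_low k) x = (\<Sum>n\<in>UNIV. christoffel g n i k x * Y_low n x)"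
proof -
  have s: "(\<Sum>m\<in>UNIV. \<Sum>n\<in>UNIV. christoffel g n i k x * (g x $ n $ m * Y x $ m)) =
      (\<Sum>n\<in>UNIV. \<Sum>m\<in>UNIV. christoffel g n i k x * (g x $ n $ m * Y x $ m))"
    by (rule sum.swap)
  have s': "(\<Sum>m\<in>UNIV. \<Sum>n\<in>UNIV. christoffel g n i m x * (g x $ k $ n * Y x $ m)) =
      (\<Sum>n\<in>UNIV. \<Sum>m\<in>UNIV. christoffel g n i m x * (g x $ k $ n * Y x $ m))"
    by (rule sum.swap)
  show ?thesis
    unfolding Y_low_def[abs_def]
    using s s'
    by (simp add: x pderiv_rules smooth_rules smooth_Y pderiv_Y pderiv_g sum.distrib sum_negf sum_subtractf
        sum_distrib_left sum_distrib_right algebra_simps)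
qed

lemma pderiv_Y_sq:
  assumes x: "x \<in> U"
  shows "pderiv_vec i Y_sq x = 0"
proof -
  have s: "(\<Sum>m\<in>UNIV. \<Sum>n\<in>UNIV. christoffel g n i m x * (Y_low n x * Y x $ m)) =
      (\<Sum>n\<in>UNIV. \<Sum>m\<in>UNIV. christoffel g n i m x * (Y_low n x * Y x $ m))"
    by (rule sum.swap)
  show ?thesis
    unfolding Y_sq_def[abs_def]
    using s
    by (simp add: x pderiv_rules smooth_rules smooth_Y smooth_Y_low pderiv_Y pderiv_Y_low sum.distrib sum_subtractf
        sum_negf sum_distrib_left sum_distrib_right algebra_simps)
qed

lemma riemann_low_Y:
  assumes x: "x \<in> U"
  shows "(\<Sum>k\<in>UNIV. riemann_low l k i j x * Y x $ k) = 0"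
proof -
  have "(\<Sum>k\<in>UNIV. riemann_low l k i j x * Y x $ k) =
      (\<Sum>m\<in>UNIV. g x $ l $ m * (\<Sum>k\<in>UNIV. riemann g m k i j x * Y x $ k))"
    unfolding riemann_low_def
    by (simp only: sum_distrib_left sum_distrib_right mult.assoc) (rule sum.swap)
  then show ?thesis
    by (simp add: riemann_parallel[OF x smooth_Y parallel_Y])
qed

text \<open>Pair symmetry moves \<open>Y\<close> from the vector slot, where it is annihilated, into
  a form slot.\<close>

lemma Y_riemann:
  assumes x: "x \<in> U"
  shows "(\<Sum>i\<in>UNIV. Y x $ i * riemann g l k i j x) = 0"
proof -
  have "(\<Sum>i\<in>UNIV. Y x $ i * riemann g l k i j x) =
      (\<Sum>p\<in>UNIV. matrix_inv (g x) $ l $ p * (\<Sum>i\<in>UNIV. riemann_low p k i j x * Y x $ i))"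
    unfolding riemann_raise[OF x]
    by (simp only: sum_distrib_left mult.left_commute[of "Y x $ _"]) (subst sum.swap, simp add: mult_ac)
  also have "\<dots> = (\<Sum>p\<in>UNIV. matrix_inv (g x) $ l $ p * (\<Sum>i\<in>UNIV. - riemann_low j i p k x * Y x $ i))"
    by (intro sum.cong refl arg_cong2[of _ _ _ _ "(*)"])
      (metis riemann_low_pair_sym[OF x] riemann_low_antisym_left[OF x])
  finally show ?thesis
    by (simp add: sum_negf riemann_low_Y[OF x])
qed

text \<open>The Leibniz rule for the vanishing contraction of \<open>Y\<close> with the curvature.
  For the full covariant derivative the result would be zero; the right side is the connection term
  of the form index that \<open>cov_riemann\<close> omits.\<close>

lemma Y_cov_riemann:
  assumes x: "x \<in> U"
  shows "(\<Sum>i\<in>UNIV. Y x $ i * cov_riemann b l m i k x) =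
    (\<Sum>i\<in>UNIV. \<Sum>n\<in>UNIV. christoffel g i b n x * Y x $ n * riemann g l m i k x)"
proof -
  have "0 = pderiv_vec b (\<lambda>y. \<Sum>i\<in>UNIV. Y y $ i * riemann g l m i k y) x"
    using pderiv_cong[OF x, of "\<lambda>y. \<Sum>i\<in>UNIV. Y y $ i * riemann g l m i k y" "\<lambda>y. 0"]
    by (simp add: Y_riemann pderiv_vec_const)
  also have "\<dots> = (\<Sum>i\<in>UNIV. Y x $ i * pderiv_vec b (riemann g l m i k) x)
      - (\<Sum>i\<in>UNIV. \<Sum>n\<in>UNIV. christoffel g i b n x * Y x $ n * riemann g l m i k x)"
    by (simp add: x pderiv_rules smooth_rules smooth_Y smooth_riemann pderiv_Y sum.distrib sum_negf sum_subtractf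
        sum_distrib_right)
  finally have d: "(\<Sum>i\<in>UNIV. Y x $ i * pderiv_vec b (riemann g l m i k) x) =
    (\<Sum>i\<in>UNIV. \<Sum>n\<in>UNIV. christoffel g i b n x * Y x $ n * riemann g l m i k x)" by simp
  \<comment> \<open>In the connection terms of \<open>cov_riemann\<close> the field still sits in a
    form slot of an undifferentiated curvature tensor, so they vanish.\<close>
  have z: "(\<Sum>i\<in>UNIV. \<Sum>n\<in>UNIV. Y x $ i * (f n * riemann g (p n) (q n) i k x)) = 0"
    for f :: "'n \<Rightarrow> real" and p q
  proof -
    have "(\<Sum>i\<in>UNIV. \<Sum>n\<in>UNIV. Y x $ i * (f n * riemann g (p n) (q n) i k x)) =
      (\<Sum>n\<in>UNIV. f n * (\<Sum>i\<in>UNIV. Y x $ i * riemann g (p n) (q n) i k x))"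
      by (subst sum.swap) (simp add: sum_distrib_left mult.left_commute)
    then show ?thesis by (simp add: Y_riemann[OF x])
  qed
  show ?thesis
    unfolding cov_riemann_def d[symmetric]
    using z[of "\<lambda>n. christoffel g l b n x" "\<lambda>n. n" "\<lambda>n. m"]
      z[of "\<lambda>n. christoffel g n b m x" "\<lambda>n. l" "\<lambda>n. n"]
    by (simp add: distrib_left right_diff_distrib sum.distrib sum_subtractf sum_distrib_left)
qed

text \<open>Contracting the second Bianchi identity with \<open>Y\<close> gives \<open>\<nabla>\<^sub>Y Ric = 0\<close>.\<close>

lemma ricci_transport:
  assumes x: "x \<in> U"
  shows "(\<Sum>i\<in>UNIV. Y x $ i * pderiv_vec i (ricci g k m) x) =
    (\<Sum>i\<in>UNIV. \<Sum>n\<in>UNIV. Y x $ i * christoffel g n i m x * ricci g k n x) +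
    (\<Sum>i\<in>UNIV. \<Sum>n\<in>UNIV. christoffel g i k n x * Y x $ n * ricci g i m x)"
proof -
  have anti: "cov_riemann a l m b c x = - cov_riemann a l m c b x" for a l b c
  proof -
    have "pderiv_vec a (riemann g l m b c) x = pderiv_vec a (\<lambda>y. - riemann g l m c b y) x"
      by (rule pderiv_cong[OF x]) (rule riemann_antisym)
    then show ?thesis
      unfolding cov_riemann_def
      by (simp add: pderiv_vec_minus[OF x smooth_riemann] riemann_antisym[of _ _ b c] sum_negf)
  qed
  have "(\<Sum>i\<in>UNIV. Y x $ i * cov_riemann i l m l k x) =
     (\<Sum>i\<in>UNIV. Y x $ i * cov_riemann l l m i k x) - (\<Sum>i\<in>UNIV. Y x $ i * cov_riemann k l m i l x)" for l
  proof -
    \<comment> \<open>The form indices are \<open>i\<close>, \<open>l\<close>, \<open>k\<close>, and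
      the repeated \<open>l\<close> prepares the trace. In both terms on the right \<open>Y\<close>
      meets a form index, where \<open>Y_cov_riemann\<close> applies.\<close>
    have "cov_riemann i l m l k x = cov_riemann l l m i k x - cov_riemann k l m i l x" for i
      using bianchi_second[OF x, of i l m l k] anti[of l l k i] by simp
    then show ?thesis by (simp add: right_diff_distrib sum_subtractf)
  qed
  then have "(\<Sum>l\<in>UNIV. \<Sum>i\<in>UNIV. Y x $ i * cov_riemann i l m l k x) =
     (\<Sum>l\<in>UNIV. \<Sum>i\<in>UNIV. \<Sum>n\<in>UNIV. christoffel g i l n x * Y x $ n * riemann g l m i k x)
     - (\<Sum>l\<in>UNIV. \<Sum>i\<in>UNIV. \<Sum>n\<in>UNIV. christoffel g i k n x * Y x $ n * riemann g l m i l x)"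
    by (simp add: Y_cov_riemann[OF x] sum_subtractf)
  \<comment> \<open>\<open>ricci\<close> contracts the upper index with the first form index, here
    it is the second; hence the sign.\<close>
  moreover have "(\<Sum>l\<in>UNIV. \<Sum>i\<in>UNIV. \<Sum>n\<in>UNIV. christoffel g i k n x * Y x $ n * riemann g l m i l x)
     = - (\<Sum>i\<in>UNIV. \<Sum>n\<in>UNIV. christoffel g i k n x * Y x $ n * ricci g i m x)"
  proof -
    have "(\<Sum>l\<in>UNIV. \<Sum>i\<in>UNIV. \<Sum>n\<in>UNIV. christoffel g i k n x * Y x $ n * riemann g l m i l x) =
      (\<Sum>i\<in>UNIV. \<Sum>n\<in>UNIV. \<Sum>l\<in>UNIV. christoffel g i k n x * Y x $ n * riemann g l m i l x)"
      by (subst sum.swap) (intro sum.cong refl sum.swap)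
    moreover have "riemann g l m i l x = - riemann g l m l i x" for l i
      by (rule riemann_antisym)
    ultimately show ?thesis
      unfolding ricci_def by (simp add: sum_distrib_left sum_negf)
  qed
  moreover have "(\<Sum>l\<in>UNIV. \<Sum>i\<in>UNIV. Y x $ i * cov_riemann i l m l k x) =
     (\<Sum>i\<in>UNIV. Y x $ i * pderiv_vec i (ricci g k m) x)
     + (\<Sum>l\<in>UNIV. \<Sum>i\<in>UNIV. \<Sum>n\<in>UNIV. Y x $ i * christoffel g l i n x * riemann g n m l k x)
     - (\<Sum>i\<in>UNIV. \<Sum>n\<in>UNIV. Y x $ i * christoffel g n i m x * ricci g k n x)"
  proof -
    have "pderiv_vec i (ricci g k m) x = (\<Sum>l\<in>UNIV. pderiv_vec i (riemann g l m l k) x)" for i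
      unfolding ricci_def[abs_def] by (simp add: pderiv_vec_sum[OF open_U x] smooth_riemann)
    moreover have "(\<Sum>l\<in>UNIV. \<Sum>i\<in>UNIV. Y x $ i * pderiv_vec i (riemann g l m l k) x) =
        (\<Sum>i\<in>UNIV. Y x $ i * (\<Sum>l\<in>UNIV. pderiv_vec i (riemann g l m l k) x))"
      by (subst sum.swap) (simp add: sum_distrib_left)
    moreover have "(\<Sum>l\<in>UNIV. \<Sum>i\<in>UNIV. \<Sum>n\<in>UNIV. Y x $ i * christoffel g n i m x * riemann g l n l k x) =
        (\<Sum>i\<in>UNIV. \<Sum>n\<in>UNIV. Y x $ i * christoffel g n i m x * ricci g k n x)"
    proof -
      have "(\<Sum>l\<in>UNIV. \<Sum>i\<in>UNIV. \<Sum>n\<in>UNIV. Y x $ i * christoffel g n i m x * riemann g l n l k x) =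
        (\<Sum>i\<in>UNIV. \<Sum>n\<in>UNIV. \<Sum>l\<in>UNIV. Y x $ i * christoffel g n i m x * riemann g l n l k x)"
        by (subst sum.swap) (intro sum.cong refl sum.swap)
      then show ?thesis by (simp add: ricci_def sum_distrib_left)
    qed
    ultimately show ?thesis
      unfolding cov_riemann_def
      by (simp add: distrib_left right_diff_distrib sum.distrib sum_subtractf sum_distrib_left mult.assoc)
  qed
  \<comment> \<open>The connection term of the traced upper index equals the term left over by
    \<open>Y_cov_riemann\<close>, by torsion-freeness. They cancel, and only the connection terms of
    the Ricci tensor remain.\<close>
  moreover have "(\<Sum>l\<in>UNIV. \<Sum>i\<in>UNIV. \<Sum>n\<in>UNIV. Y x $ i * christoffel g l i n x * riemann g n m l k x) =
     (\<Sum>l\<in>UNIV. \<Sum>i\<in>UNIV. \<Sum>n\<in>UNIV. christoffel g i l n x * Y x $ n * riemann g l m i k x)"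
  proof -
    have "(\<Sum>l\<in>UNIV. \<Sum>i\<in>UNIV. \<Sum>n\<in>UNIV. Y x $ i * christoffel g l i n x * riemann g n m l k x) =
      (\<Sum>l\<in>UNIV. \<Sum>n\<in>UNIV. \<Sum>i\<in>UNIV. Y x $ i * christoffel g l i n x * riemann g n m l k x)"
      by (intro sum.cong refl sum.swap)
    also have "\<dots> = (\<Sum>n\<in>UNIV. \<Sum>l\<in>UNIV. \<Sum>i\<in>UNIV. Y x $ i * christoffel g l i n x * riemann g n m l k x)"
      by (rule sum.swap)
    also have "\<dots> = (\<Sum>n\<in>UNIV. \<Sum>l\<in>UNIV. \<Sum>i\<in>UNIV. christoffel g l n i x * Y x $ i * riemann g n m l k x)"
      by (intro sum.cong refl) (simp add: christoffel_sym[OF x] mult_ac)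
    finally show ?thesis .
  qed
  ultimately show ?thesis by simp
qed

end


section \<open>Parallel fields in dimension three\<close>

text \<open>The contraction of \<open>y\<close> into the coordinate volume form. As a determinant it
  is open to the multiplicativity of \<open>det\<close> in \<open>gram_area_form\<close>.\<close>

definition area_form :: "real^3 \<Rightarrow> 3 \<Rightarrow> 3 \<Rightarrow> real" where
  "area_form y i j = det (vector [axis i 1, axis j 1, y] :: real^3^3)"

lemma area_form_simps:
  "area_form y 1 1 = 0" "area_form y 2 2 = 0" "area_form y 3 3 = 0"
  "area_form y 1 2 = y $ 3" "area_form y 2 1 = - y $ 3"
  "area_form y 2 3 = y $ 1" "area_form y 3 2 = - y $ 1"
  "area_form y 3 1 = y $ 2" "area_form y 1 3 = - y $ 2"
  by (simp_all add: area_form_def det_3 vector_3 axis_def)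

text \<open>An antisymmetric 3 by 3 matrix acts, up to sign, as the cross product with the vector of
  its entries \<open>A 2 3\<close>, \<open>A 3 1\<close>, \<open>A 1 2\<close>, so annihilating
  \<open>y\<close> makes that vector parallel to \<open>y\<close>. The factor is its projection
  coefficient, taken in the Euclidean product of the coordinates.\<close>

lemma antisym_annihilating:
  fixes A :: "3 \<Rightarrow> 3 \<Rightarrow> real"
  assumes anti: "\<And>i j. A i j = - A j i" and kill: "\<And>i. (\<Sum>j\<in>UNIV. A i j * y $ j) = 0" and y: "y \<noteq> 0"
  shows "A i j = (A 2 3 * y $ 1 + A 3 1 * y $ 2 + A 1 2 * y $ 3) / (y \<bullet> y) * area_form y i j"
proof -
  define c where "c = (A 2 3 * y $ 1 + A 3 1 * y $ 2 + A 1 2 * y $ 3) / (y \<bullet> y)"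
  have n: "y \<bullet> y = y $ 1 * y $ 1 + y $ 2 * y $ 2 + y $ 3 * y $ 3"
    by (simp add: inner_vec_def sum_3)
  have n0: "y \<bullet> y \<noteq> 0" using y by simp
  have z: "A 1 1 = 0" "A 2 2 = 0" "A 3 3 = 0"
    using anti[of 1 1] anti[of 2 2] anti[of 3 3] by simp_all
  have k: "A 1 2 * y $ 2 - A 3 1 * y $ 3 = 0" "A 2 3 * y $ 3 - A 1 2 * y $ 1 = 0"
    "A 3 1 * y $ 1 - A 2 3 * y $ 2 = 0"
    using kill[of 1] kill[of 2] kill[of 3] z anti[of 1 3] anti[of 2 1] anti[of 3 2]
    by (simp_all add: sum_3)
  have "A 1 2 * (y \<bullet> y) = (A 2 3 * y $ 1 + A 3 1 * y $ 2 + A 1 2 * y $ 3) * y $ 3"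
    "A 2 3 * (y \<bullet> y) = (A 2 3 * y $ 1 + A 3 1 * y $ 2 + A 1 2 * y $ 3) * y $ 1"
    "A 3 1 * (y \<bullet> y) = (A 2 3 * y $ 1 + A 3 1 * y $ 2 + A 1 2 * y $ 3) * y $ 2"
    unfolding n using k by algebra+
  then have "A 1 2 = c * y $ 3" "A 2 3 = c * y $ 1" "A 3 1 = c * y $ 2"
    using n0 by (simp_all add: c_def field_simps)
  moreover have "i = 1 \<or> i = 2 \<or> i = 3" "j = 1 \<or> j = 2 \<or> j = 3" by (rule exhaust_3)+
  ultimately show ?thesis
    unfolding c_def[symmetric]
    using z anti[of 1 3] anti[of 2 1] anti[of 3 2] by (auto simp: area_form_simps)
qed

text \<open>\<open>antisym_annihilating\<close> is used twice: on the first index pair with the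
  second fixed, and then on the coefficient \<open>c\<close>, which inherits antisymmetry and
  annihilation of \<open>y\<close> through pair symmetry.\<close>

lemma curvature_form_annihilating:
  fixes R :: "3 \<Rightarrow> 3 \<Rightarrow> 3 \<Rightarrow> 3 \<Rightarrow> real"
  assumes anti: "\<And>l k i j. R l k i j = - R k l i j" and pair: "\<And>l k i j. R l k i j = R i j l k"
    and kill: "\<And>l i j. (\<Sum>k\<in>UNIV. R l k i j * y $ k) = 0" and y: "y \<noteq> 0"
  shows "\<exists>\<kappa>. \<forall>l k i j. R l k i j = \<kappa> * (area_form y l k * area_form y i j)"
proof -
  define c where "c i j = (R 2 3 i j * y $ 1 + R 3 1 i j * y $ 2 + R 1 2 i j * y $ 3) / (y \<bullet> y)" for i j
  have R: "R l k i j = c i j * area_form y l k" for l k i j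
    unfolding c_def using antisym_annihilating[of "\<lambda>l k. R l k i j" y l k] anti kill y by blast
  have ca: "c i j = - c j i" for i j
  proof -
    have "R l k i j = - R l k j i" for l k using anti pair by metis
    from this[of 2 3] this[of 3 1] this[of 1 2] show ?thesis
      unfolding c_def minus_divide_left by (intro arg_cong2[where f = "(/)"]) simp_all
  qed
  have ck: "(\<Sum>j\<in>UNIV. c i j * y $ j) = 0" for i
  proof -
    have "(\<Sum>j\<in>UNIV. R l k i j * y $ j) = 0" for l k
      using kill[of i l k] by (simp add: pair[of l k])
    then have 0: "(\<Sum>j\<in>UNIV. R l k i j * y $ j) * t = 0" for l k t by simp
    have "(\<Sum>j\<in>UNIV. c i j * y $ j) = ((\<Sum>j\<in>UNIV. R 2 3 i j * y $ j) * y $ 1 +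
       (\<Sum>j\<in>UNIV. R 3 1 i j * y $ j) * y $ 2 + (\<Sum>j\<in>UNIV. R 1 2 i j * y $ j) * y $ 3) / (y \<bullet> y)"
      unfolding c_def sum_3 add_divide_distrib[symmetric] times_divide_eq_left
      by (rule arg_cong2[where f = "(/)"]) (simp_all add: algebra_simps)
    then show ?thesis unfolding 0 by simp
  qed
  obtain \<kappa> where "c i j = \<kappa> * area_form y i j" for i j
    using antisym_annihilating[OF ca ck y] by blast
  then show ?thesis
    using R by (intro exI[of _ \<kappa>]) (simp add: mult_ac)
qed

text \<open>The Gram determinant of \<open>(e\<^sub>l, e\<^sub>k, y)\<close> against \<open>(e\<^sub>i, e\<^sub>j, y)\<close>.\<close>

lemma gram_area_form:
  fixes Q :: "real^3^3" and y :: "real^3"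
  assumes sym: "\<And>i j. Q $ i $ j = Q $ j $ i"
  defines "q \<equiv> \<lambda>k. \<Sum>m\<in>UNIV. Q $ k $ m * y $ m"
  defines "a \<equiv> \<Sum>k\<in>UNIV. q k * y $ k"
  shows "det Q * (area_form y l k * area_form y i j) =
    a * (Q $ l $ i * Q $ k $ j - Q $ l $ j * Q $ k $ i)
    - Q $ l $ i * q k * q j - q l * q i * Q $ k $ j + Q $ l $ j * q k * q i + q l * q j * Q $ k $ i"
proof -
  define P where "P i j = (vector [axis i 1, axis j 1, y] :: real^3^3)" for i j
  have t: "(P l k ** Q ** transpose (P i j)) $ r $ s =
      (\<Sum>n\<in>UNIV. (\<Sum>m\<in>UNIV. P l k $ r $ m * Q $ m $ n) * P i j $ s $ n)" for r s
    by (simp add: matrix_matrix_mult_def transpose_def)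
  have q0: "(\<Sum>m\<in>UNIV. Q $ n $ m * y $ m) = q n" for n
    unfolding q_def ..
  have q': "(\<Sum>m\<in>UNIV. y $ m * Q $ m $ n) = q n" for n
    unfolding q_def by (simp add: sym[of _ n] mult.commute)
  have ax: "(\<Sum>m\<in>UNIV. axis b 1 $ m * f m) = f b" "(\<Sum>m\<in>UNIV. f m * axis b 1 $ m) = f b"
    for b :: 3 and f :: "3 \<Rightarrow> real"
    by (simp_all add: axis_def if_distrib[of "\<lambda>z. z * _"] if_distrib[of "\<lambda>z. _ * z"] cong: if_cong)
  \<comment> \<open>The same determinant is evaluated by multiplicativity and by expanding the Gram
    matrix, whose entries are those of \<open>Q\<close>, \<open>q\<close> and
    \<open>a\<close>.\<close>
  have "det (P l k ** Q ** transpose (P i j)) = det Q * (area_form y l k * area_form y i j)"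
    by (simp add: det_mul det_transpose area_form_def P_def)
  moreover have "det (P l k ** Q ** transpose (P i j)) =
    a * (Q $ l $ i * Q $ k $ j - Q $ l $ j * Q $ k $ i)
    - Q $ l $ i * q k * q j - q l * q i * Q $ k $ j + Q $ l $ j * q k * q i + q l * q j * Q $ k $ i"
    unfolding det_3 t unfolding P_def vector_3 ax q' q0 a_def[symmetric]
    by (simp add: algebra_simps)
  ultimately show ?thesis by simp
qed

locale parallel_field_3 = parallel_field U g Y for U :: "(real^3) set" and g Y
begin

text \<open>The sectional curvature of the plane orthogonal to \<open>Y\<close>, divided by |Y|^2.
  Going through the scalar curvature makes it smooth at once, whereas the pointwise factor in
  \<open>curvature_form_annihilating\<close> is merely known to exist.\<close>

definition rho :: "real^3 \<Rightarrow> real" where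
  "rho x = scalar_curv g x / (2 * Y_sq x)"

lemma smooth_rho: "smooth_on rho U"
  unfolding rho_def[abs_def]
  by (intro smooth_on_divide smooth_rules open_U smooth_scalar_curv smooth_Y_sq) (simp add: Y_sq_nonzero)

lemma g_inv_Y_low: "x \<in> U \<Longrightarrow> (\<Sum>p\<in>UNIV. matrix_inv (g x) $ i $ p * Y_low p x) = Y x $ i"
  by (simp add: Y_low_def raise_lower)

lemma curvature_structure:
  assumes x: "x \<in> U"
  shows "riemann_low l k i j x = rho x *
     (Y_sq x * (g x $ l $ i * g x $ k $ j - g x $ l $ j * g x $ k $ i)
      - g x $ l $ i * Y_low k x * Y_low j x - Y_low l x * Y_low i x * g x $ k $ j
      + g x $ l $ j * Y_low k x * Y_low i x + Y_low l x * Y_low j x * g x $ k $ i)" (is ?R)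
    and ricci_structure: "ricci g j k x = rho x * (Y_sq x * g x $ j $ k - Y_low j x * Y_low k x)" (is ?S)
proof -
  let ?B = "\<lambda>l k i j. Y_sq x * (g x $ l $ i * g x $ k $ j - g x $ l $ j * g x $ k $ i)
      - g x $ l $ i * Y_low k x * Y_low j x - Y_low l x * Y_low i x * g x $ k $ j
      + g x $ l $ j * Y_low k x * Y_low i x + Y_low l x * Y_low j x * g x $ k $ i"
  have Y0: "Y x \<noteq> 0"
    using Y_sq_nonzero[OF x] by (auto simp: Y_sq_def)
  have dg: "det (g x) \<noteq> 0"
    using g_invertible[OF x] by (simp add: invertible_det_nz)
  obtain \<kappa> where \<kappa>: "riemann_low l k i j x = \<kappa> * (area_form (Y x) l k * area_form (Y x) i j)" for l k i j
    using curvature_form_annihilating[of "\<lambda>l k i j. riemann_low l k i j x" "Y x"]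
      riemann_low_antisym_left[OF x] riemann_low_pair_sym[OF x] riemann_low_Y[OF x] Y0 by blast
  \<comment> \<open>Dividing by the determinant passes from the coordinate area forms to the
    expression in \<open>g\<close> and \<open>Y_low\<close> given by
    \<open>gram_area_form\<close>.\<close>
  define r where "r = \<kappa> / det (g x)"
  have R: "riemann_low l k i j x = r * ?B l k i j" for l k i j
  proof -
    have "?B l k i j = det (g x) * (area_form (Y x) l k * area_form (Y x) i j)"
      using gram_area_form[OF g_sym[OF x], where y = "Y x" and l = l and k = k and i = i and j = j]
      by (simp only: Y_low_def Y_sq_def)
    then show ?thesis
      unfolding \<kappa> r_def by (simp only:) (simp add: dg)
  qed
  have S: "ricci g j k x = r * (Y_sq x * g x $ j $ k - Y_low j x * Y_low k x)" for j k
  proof -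
    let ?I = "\<lambda>i p. matrix_inv (g x) $ i $ p"
    have "(\<Sum>p\<in>UNIV. ?I i p * riemann_low p k i j x) =
      r * (Y_sq x * ((\<Sum>p\<in>UNIV. ?I i p * g x $ p $ i) * g x $ k $ j - (\<Sum>p\<in>UNIV. ?I i p * g x $ p $ j) * g x $ k $ i)
      - (\<Sum>p\<in>UNIV. ?I i p * g x $ p $ i) * Y_low k x * Y_low j x
      - (\<Sum>p\<in>UNIV. ?I i p * Y_low p x) * Y_low i x * g x $ k $ j
      + (\<Sum>p\<in>UNIV. ?I i p * g x $ p $ j) * Y_low k x * Y_low i x
      + (\<Sum>p\<in>UNIV. ?I i p * Y_low p x) * Y_low j x * g x $ k $ i)" for i
      unfolding R sum_3 by (simp add: algebra_simps)
    then have "riemann g i k i j x =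
      r * (Y_sq x * (g x $ k $ j - (if i = j then 1 else 0) * g x $ k $ i)
      - Y_low k x * Y_low j x - Y x $ i * Y_low i x * g x $ k $ j
      + (if i = j then 1 else 0) * Y_low k x * Y_low i x + Y x $ i * Y_low j x * g x $ k $ i)" for i
      unfolding riemann_raise[OF x, of i] g_inv_g[OF x] g_inv_Y_low[OF x] by simp
    then have "ricci g j k x = (\<Sum>i\<in>UNIV.
      r * (Y_sq x * (g x $ k $ j - (if i = j then 1 else 0) * g x $ k $ i)
      - Y_low k x * Y_low j x - Y x $ i * Y_low i x * g x $ k $ j
      + (if i = j then 1 else 0) * Y_low k x * Y_low i x + Y x $ i * Y_low j x * g x $ k $ i))"
      unfolding ricci_def by simp
    also have "\<dots> = r * (Y_sq x * (3 * g x $ k $ j - g x $ k $ j) - 3 * (Y_low k x * Y_low j x)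
      - (\<Sum>i\<in>UNIV. Y_low i x * Y x $ i) * g x $ k $ j + Y_low k x * Y_low j x
      + Y_low j x * (\<Sum>i\<in>UNIV. g x $ k $ i * Y x $ i))"
      using exhaust_3[of j] by (elim disjE) (simp_all add: sum_3 algebra_simps)
    finally have "ricci g j k x = r * (Y_sq x * (3 * g x $ k $ j - g x $ k $ j) - 3 * (Y_low k x * Y_low j x)
      - Y_sq x * g x $ k $ j + Y_low k x * Y_low j x + Y_low j x * Y_low k x)"
      by (simp only: Y_sq_def[symmetric] Y_low_def[symmetric])
    then show ?thesis using g_sym[OF x, of k j] by (simp add: algebra_simps)
  qed
  \<comment> \<open>The trace of the Ricci formula is r (3 |Y|^2 - |Y|^2), which identifies the
    pointwise factor \<open>r\<close> with \<open>rho\<close>.\<close>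
  have "scalar_curv g x = r * (2 * Y_sq x)"
  proof -
    let ?I = "\<lambda>i p. matrix_inv (g x) $ i $ p"
    have "(\<Sum>k\<in>UNIV. ?I j k * ricci g j k x) =
      r * (Y_sq x * (\<Sum>k\<in>UNIV. ?I j k * g x $ k $ j) - (\<Sum>k\<in>UNIV. ?I j k * Y_low k x) * Y_low j x)" for j
      unfolding S sum_3 by (simp add: algebra_simps g_sym[OF x, of j])
    then have "(\<Sum>k\<in>UNIV. ?I j k * ricci g j k x) = r * (Y_sq x - Y_low j x * Y x $ j)" for j
      unfolding g_inv_g[OF x] g_inv_Y_low[OF x] by (simp add: mult.commute)
    then have "scalar_curv g x = (\<Sum>j\<in>UNIV. r * (Y_sq x - Y_low j x * Y x $ j))"
      by (simp add: scalar_curv_def)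
    also have "\<dots> = r * (3 * Y_sq x - (\<Sum>j\<in>UNIV. Y_low j x * Y x $ j))"
      by (simp add: sum_3 algebra_simps)
    finally show ?thesis
      by (simp add: Y_sq_def[symmetric])
  qed
  then have "rho x = r"
    using Y_sq_nonzero[OF x] by (simp add: rho_def)
  with R S show ?R ?S by auto
qed

text \<open>Put the Ricci formula into \<open>ricci_transport\<close>: the metric and
  \<open>Y_low\<close> are parallel, so what survives is the derivative of \<open>rho\<close> along
  \<open>Y\<close> times a tensor that is not zero.\<close>

lemma Y_rho:
  assumes x: "x \<in> U"
  shows "(\<Sum>i\<in>UNIV. Y x $ i * pderiv_vec i rho x) = 0" (is "?Yr = 0")
proof -
  have "?Yr * (Y_sq x * g x $ k $ m - Y_low k x * Y_low m x) = 0" for k m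
  proof -
    have "pderiv_vec i (ricci g k m) x =
        pderiv_vec i (\<lambda>y. rho y * (Y_sq y * g y $ k $ m - Y_low k y * Y_low m y)) x" for i
      by (rule pderiv_cong[OF x ricci_structure])
    then have d: "pderiv_vec i (ricci g k m) x = pderiv_vec i rho x * (Y_sq x * g x $ k $ m
        - Y_low k x * Y_low m x) +
       rho x * (Y_sq x * ((\<Sum>n\<in>UNIV. christoffel g n i k x * g x $ n $ m)
           + (\<Sum>n\<in>UNIV. christoffel g n i m x * g x $ k $ n))
        - (Y_low k x * (\<Sum>n\<in>UNIV. christoffel g n i m x * Y_low n x)
          + (\<Sum>n\<in>UNIV. christoffel g n i k x * Y_low n x) * Y_low m x))" for i
      by (simp add: x pderiv_rules smooth_rules smooth_rho smooth_Y_sq smooth_Y_low pderiv_Y_sq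
          pderiv_Y_low pderiv_g)
    have "(\<Sum>i\<in>UNIV. \<Sum>n\<in>UNIV. christoffel g i k n x * Y x $ n * ricci g i m x) =
        (\<Sum>i\<in>UNIV. \<Sum>n\<in>UNIV. Y x $ i * christoffel g n i k x * ricci g n m x)"
      by (subst sum.swap) (simp add: christoffel_sym[OF x, of _ k] mult_ac)
    with ricci_transport[OF x, of k m] show ?thesis
      unfolding d ricci_structure[OF x]
      by (simp add: sum_distrib_left sum_distrib_right sum.distrib sum_subtractf algebra_simps)
  qed
  then have "?Yr = 0 \<or> (\<forall>k m. Y_sq x * g x $ k $ m = Y_low k x * Y_low m x)" by force
  \<comment> \<open>If that tensor vanished, its trace would give 3 |Y|^2 = |Y|^2.\<close>
  moreover have False if e: "\<forall>k m. Y_sq x * g x $ k $ m = Y_low k x * Y_low m x"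
  proof -
    have "Y_sq x = Y x $ i * Y_low i x" for i
    proof -
      have "Y_sq x = Y_sq x * (\<Sum>p\<in>UNIV. matrix_inv (g x) $ i $ p * g x $ p $ i)"
        by (simp add: g_inv_g[OF x])
      also have "\<dots> = (\<Sum>p\<in>UNIV. matrix_inv (g x) $ i $ p * (Y_sq x * g x $ p $ i))"
        by (simp add: sum_distrib_left mult_ac)
      also have "\<dots> = (\<Sum>p\<in>UNIV. matrix_inv (g x) $ i $ p * Y_low p x) * Y_low i x"
        using e by (simp add: sum_distrib_left sum_distrib_right mult_ac)
      finally show ?thesis by (simp add: g_inv_Y_low[OF x])
    qed
    then have "3 * Y_sq x = (\<Sum>i\<in>UNIV. Y x $ i * Y_low i x)"
      by (simp add: sum_3)
    then have "2 * Y_sq x = 0" by (simp add: Y_sq_def mult.commute)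
    with Y_sq_nonzero[OF x] show False by simp
  qed
  ultimately show ?thesis by blast
qed

end


section \<open>Conformal change of the metric\<close>

lemma matrix_inv_eqI:
  fixes B C :: "real^'n^'n"
  assumes "B ** C = mat 1"
  shows "matrix_inv B = C"
proof -
  have "invertible B"
    using assms matrix_left_right_inverse[of B C] by (auto simp: invertible_def)
  then show ?thesis
    by (metis assms matrix_inv_invertible(2) matrix_mul_assoc matrix_mul_lid matrix_mul_rid)
qed

lemma matrix_inv_scale:
  fixes B :: "real^'n^'n"
  assumes "invertible B" "c \<noteq> 0"
  shows "matrix_inv (c *\<^sub>R B) = inverse c *\<^sub>R matrix_inv B"
proof (rule matrix_inv_eqI)
  have "(c *\<^sub>R B) ** (inverse c *\<^sub>R matrix_inv B) = B ** matrix_inv B"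
    using assms(2) by (simp add: matrix_matrix_mult_def vec_eq_iff field_simps)
  then show "(c *\<^sub>R B) ** (inverse c *\<^sub>R matrix_inv B) = mat 1"
    by (simp add: matrix_inv_invertible(1)[OF assms(1)])
qed

text \<open>The shape of a contraction with the upper index of \<open>chr_diff\<close>;
  \<open>sum_delta_lower\<close> does the same for a lower index.\<close>

lemma sum_delta_upper:
  fixes f w :: "'n::finite \<Rightarrow> real"
  shows "(\<Sum>m\<in>UNIV. f m * ((if m = j then 1 else 0) * a + (if m = k then 1 else 0) * b - c * w m)) =
    f j * a + f k * b - c * (\<Sum>m\<in>UNIV. f m * w m)"
proof -
  have d: "(\<Sum>m\<in>UNIV. f m * ((if m = j then 1 else 0) * a)) = f j * a" for j a
    by (simp add: if_distrib[of "\<lambda>z. z * _"] if_distrib[of "\<lambda>z. _ * z"] cong: if_cong)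
  show ?thesis
    using d[of j a] d[of k b]
    by (simp add: distrib_left right_diff_distrib sum.distrib sum_subtractf sum_distrib_left mult.left_commute)
qed

lemma sum_delta_lower:
  fixes f p q :: "'n::finite \<Rightarrow> real"
  shows "(\<Sum>m\<in>UNIV. f m * (d * p m + (if l = m then 1 else 0) * b - q m * c)) =
    d * (\<Sum>m\<in>UNIV. f m * p m) + f l * b - (\<Sum>m\<in>UNIV. f m * q m) * c"
proof -
  have d: "(\<Sum>m\<in>UNIV. f m * ((if l = m then 1 else 0) * a)) = f l * a" for a
    by (simp add: if_distrib[of "\<lambda>z. z * _"] if_distrib[of "\<lambda>z. _ * z"] cong: if_cong)
  show ?thesis
    using d[of b]
    by (simp add: distrib_left right_diff_distrib sum.distrib sum_subtractf sum_distrib_left sum_distrib_right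
        mult.left_commute mult.assoc)
qed

locale conformal_change = metric_domain U g for U :: "(real^'n) set" and g +
  fixes u :: "real^'n \<Rightarrow> real" and G :: "real^'n \<Rightarrow> real^'n^'n"
  assumes smooth_u: "smooth_on u U"
    and G_eq: "x \<in> U \<Longrightarrow> G x = exp (2 * u x) *\<^sub>R g x"
begin

abbreviation du :: "'n \<Rightarrow> real^'n \<Rightarrow> real" where
  "du k \<equiv> pderiv_vec k u"

definition grad :: "'n \<Rightarrow> real^'n \<Rightarrow> real" where
  "grad l x = (\<Sum>m\<in>UNIV. matrix_inv (g x) $ l $ m * du m x)"

definition hess :: "'n \<Rightarrow> 'n \<Rightarrow> real^'n \<Rightarrow> real" where
  "hess = cov1 du"

definition cov_grad :: "'n \<Rightarrow> 'n \<Rightarrow> real^'n \<Rightarrow> real" where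
  "cov_grad i l x = pderiv_vec i (grad l) x + (\<Sum>m\<in>UNIV. christoffel g l i m x * grad m x)"

definition grad_sq :: "real^'n \<Rightarrow> real" where
  "grad_sq x = (\<Sum>m\<in>UNIV. grad m x * du m x)"

definition laplace :: "real^'n \<Rightarrow> real" where
  "laplace x = (\<Sum>i\<in>UNIV. cov_grad i i x)"

text \<open>The difference of the Levi-Civita connections of \<open>G\<close> and \<open>g\<close>.
  It is a tensor, so it has a covariant derivative, computed in \<open>cov_chr_diff\<close>.\<close>

definition chr_diff :: "'n \<Rightarrow> 'n \<Rightarrow> 'n \<Rightarrow> real^'n \<Rightarrow> real" where
  "chr_diff l i j x = (if l = i then 1 else 0) * du j x + (if l = j then 1 else 0) * du i x
     - g x $ i $ j * grad l x"

lemma smooth_du: "smooth_on (du k) U"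
  by (intro smooth_rules smooth_u)

lemma smooth_grad: "smooth_on (grad l) U"
  unfolding grad_def[abs_def] by (intro smooth_rules smooth_g_inv smooth_u)

lemma smooth_grad_sq: "smooth_on grad_sq U"
  unfolding grad_sq_def[abs_def] by (intro smooth_rules smooth_grad smooth_u)

lemma smooth_hess: "smooth_on (hess j k) U"
  unfolding hess_def by (intro smooth_cov1 smooth_du)

lemma smooth_chr_diff: "smooth_on (chr_diff l i j) U"
  unfolding chr_diff_def[abs_def] by (intro smooth_rules smooth_grad smooth_u)

lemma lower_grad: "x \<in> U \<Longrightarrow> (\<Sum>l\<in>UNIV. g x $ k $ l * grad l x) = du k x"
  by (simp add: grad_def lower_raise)

lemma pderiv_du: "pderiv_vec i (du k) x = hess i k x + (\<Sum>m\<in>UNIV. christoffel g m i k x * du m x)"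
  by (simp add: hess_def cov1_def)

lemma hess_sym: "x \<in> U \<Longrightarrow> hess i k x = hess k i x"
  using pderiv_vec_commute[OF open_U _ smooth_u, of x i k]
  by (simp add: hess_def cov1_def christoffel_sym[of x _ i k])

text \<open>Metric compatibility again: lowering an index commutes with covariant differentiation,
  so the derivative of the gradient lowers to the Hessian.\<close>

lemma lower_cov_grad:
  assumes x: "x \<in> U"
  shows "(\<Sum>l\<in>UNIV. g x $ k $ l * cov_grad i l x) = hess i k x"
proof -
  have "pderiv_vec i (du k) x = pderiv_vec i (\<lambda>y. \<Sum>l\<in>UNIV. g y $ k $ l * grad l y) x"
    by (rule pderiv_cong[OF x]) (simp add: lower_grad)
  also have "\<dots> = (\<Sum>l\<in>UNIV. g x $ k $ l * pderiv_vec i (grad l) x +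
     ((\<Sum>m\<in>UNIV. christoffel g m i k x * g x $ m $ l) + (\<Sum>m\<in>UNIV. christoffel g m i l x * g x $ k $ m)) * grad l x)"
    by (simp add: x pderiv_rules smooth_rules smooth_grad pderiv_g)
  also have "\<dots> = (\<Sum>l\<in>UNIV. g x $ k $ l * pderiv_vec i (grad l) x)
     + (\<Sum>l\<in>UNIV. \<Sum>m\<in>UNIV. christoffel g m i k x * (g x $ m $ l * grad l x))
     + (\<Sum>l\<in>UNIV. \<Sum>m\<in>UNIV. g x $ k $ m * (christoffel g m i l x * grad l x))"
    by (simp add: distrib_left distrib_right sum.distrib sum_distrib_left sum_distrib_right mult_ac)
  also have "\<dots> = (\<Sum>l\<in>UNIV. g x $ k $ l * pderiv_vec i (grad l) x)
     + (\<Sum>m\<in>UNIV. christoffel g m i k x * du m x)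
     + (\<Sum>m\<in>UNIV. g x $ k $ m * (\<Sum>l\<in>UNIV. christoffel g m i l x * grad l x))"
    unfolding lower_grad[OF x, symmetric] sum_distrib_left
    by (intro arg_cong2[of _ _ _ _ "(+)"] refl sum.swap)
  also have "\<dots> = (\<Sum>l\<in>UNIV. g x $ k $ l * cov_grad i l x) + (\<Sum>m\<in>UNIV. christoffel g m i k x * du m x)"
    by (simp add: cov_grad_def distrib_left sum.distrib)
  finally show ?thesis by (simp add: pderiv_du)
qed

lemma laplace_eq:
  assumes x: "x \<in> U"
  shows "laplace x = (\<Sum>i\<in>UNIV. \<Sum>k\<in>UNIV. matrix_inv (g x) $ i $ k * hess i k x)"
  unfolding laplace_def lower_cov_grad[OF x, symmetric] by (simp add: raise_lower[OF x])

lemma pderiv_grad_sq: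
  assumes x: "x \<in> U"
  shows "pderiv_vec i grad_sq x = 2 * (\<Sum>m\<in>UNIV. grad m x * hess i m x)"
proof -
  have "pderiv_vec i grad_sq x =
      (\<Sum>m\<in>UNIV. grad m x * (hess i m x + (\<Sum>n\<in>UNIV. christoffel g n i m x * du n x)) +
         (cov_grad i m x - (\<Sum>n\<in>UNIV. christoffel g m i n x * grad n x)) * du m x)"
    unfolding grad_sq_def[abs_def]
    by (simp add: x pderiv_rules smooth_rules smooth_grad smooth_u pderiv_du cov_grad_def)
  also have "\<dots> = (\<Sum>m\<in>UNIV. grad m x * hess i m x) + (\<Sum>m\<in>UNIV. cov_grad i m x * du m x)
     + (\<Sum>m\<in>UNIV. \<Sum>n\<in>UNIV. grad m x * (christoffel g n i m x * du n x))
     - (\<Sum>m\<in>UNIV. \<Sum>n\<in>UNIV. grad n x * (christoffel g m i n x * du m x))"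
    by (simp add: distrib_left distrib_right left_diff_distrib right_diff_distrib sum.distrib sum_subtractf sum_distrib_left
        sum_distrib_right mult_ac)
  also have "(\<Sum>m\<in>UNIV. \<Sum>n\<in>UNIV. grad n x * (christoffel g m i n x * du m x)) =
     (\<Sum>m\<in>UNIV. \<Sum>n\<in>UNIV. grad m x * (christoffel g n i m x * du n x))"
    by (rule sum.swap)
  also have "(\<Sum>m\<in>UNIV. cov_grad i m x * du m x) = (\<Sum>m\<in>UNIV. \<Sum>l\<in>UNIV. grad l x * (g x $ l $ m * cov_grad i m x))"
    unfolding lower_grad[OF x, symmetric] sum_distrib_left
    by (simp add: g_sym[OF x, of _ "_::'n"] mult_ac)
  also have "\<dots> = (\<Sum>l\<in>UNIV. grad l x * (\<Sum>m\<in>UNIV. g x $ l $ m * cov_grad i m x))"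
    unfolding sum_distrib_left by (rule sum.swap)
  finally show ?thesis by (simp add: lower_cov_grad[OF x])
qed

section \<open>Connection and curvature of the rescaled metric\<close>

lemma pderiv_G:
  assumes x: "x \<in> U"
  shows "pderiv_vec i (\<lambda>y. G y $ j $ k) x =
    exp (2 * u x) * (2 * du i x * g x $ j $ k + pderiv_vec i (\<lambda>y. g y $ j $ k) x)"
proof -
  have "pderiv_vec i (\<lambda>y. G y $ j $ k) x = pderiv_vec i (\<lambda>y. exp (2 * u y) * g y $ j $ k) x"
    by (rule pderiv_cong[OF x]) (simp add: G_eq)
  then show ?thesis
    by (simp add: x pderiv_rules smooth_rules smooth_u smooth_on_exp[OF open_U] pderiv_vec_exp[of _ U]
        algebra_simps)
qed

lemma G_inv: "x \<in> U \<Longrightarrow> matrix_inv (G x) $ i $ j = exp (- 2 * u x) * matrix_inv (g x) $ i $ j"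
  by (simp add: G_eq matrix_inv_scale g_invertible exp_minus)

lemma christoffel_conformal:
  assumes x: "x \<in> U"
  shows "christoffel G l i j x = christoffel g l i j x + chr_diff l i j x"
proof -
  let ?I = "\<lambda>m. matrix_inv (g x) $ l $ m"
  have e: "exp (- 2 * u x) * a * (exp (2 * u x) * b) = a * b" for a b
    by (simp add: exp_minus field_simps)
  have s: "(\<Sum>m\<in>UNIV. ?I m * g x $ b $ m) = (if l = b then 1 else 0)" for b
    using g_inv_g[OF x, of l b] by (simp add: g_sym[OF x, of b])
  have "christoffel G l i j x = 1/2 * (\<Sum>m\<in>UNIV. ?I m * (
       (2 * du i x * g x $ j $ m + pderiv_vec i (\<lambda>y. g y $ j $ m) x)
     + (2 * du j x * g x $ i $ m + pderiv_vec j (\<lambda>y. g y $ i $ m) x)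
     - (2 * du m x * g x $ i $ j + pderiv_vec m (\<lambda>y. g y $ i $ j) x)))"
    unfolding christoffel_def G_inv[OF x] pderiv_G[OF x] e distrib_left[symmetric]
      right_diff_distrib[symmetric] ..
  also have "\<dots> = christoffel g l i j x + (\<Sum>m\<in>UNIV. ?I m * g x $ j $ m) * du i x
     + (\<Sum>m\<in>UNIV. ?I m * g x $ i $ m) * du j x - g x $ i $ j * grad l x"
    unfolding christoffel_def grad_def
    by (simp add: sum.distrib sum_subtractf sum_distrib_left sum_distrib_right algebra_simps)
  finally show ?thesis
    unfolding s by (simp add: chr_diff_def)
qed

text \<open>The left side is the covariant derivative of \<open>chr_diff\<close>, with its symmetry
  used in the last sum. Kronecker delta and metric are parallel, so only the derivatives of
  \<open>u\<close> are left.\<close>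

lemma cov_chr_diff:
  assumes x: "x \<in> U"
  shows "pderiv_vec i (chr_diff l j k) x + (\<Sum>m\<in>UNIV. christoffel g l i m x * chr_diff m j k x)
      - (\<Sum>m\<in>UNIV. christoffel g m i k x * chr_diff l j m x)
      - (\<Sum>m\<in>UNIV. christoffel g m i j x * chr_diff l k m x)
    = (if l = j then 1 else 0) * hess i k x + (if l = k then 1 else 0) * hess i j x
      - g x $ j $ k * cov_grad i l x"
proof -
  have 0: "pderiv_vec i (chr_diff l j k) x =
    (if l = j then 1 else 0) * pderiv_vec i (du k) x + (if l = k then 1 else 0) * pderiv_vec i (du j) x
    - (g x $ j $ k * pderiv_vec i (grad l) x + pderiv_vec i (\<lambda>y. g y $ j $ k) x * grad l x)"
    unfolding chr_diff_def[abs_def]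
    by (simp add: x pderiv_rules smooth_rules smooth_grad smooth_u)
  have 2: "(\<Sum>m\<in>UNIV. christoffel g m i k' x * chr_diff l j' m x) =
      (if l = j' then 1 else 0) * (\<Sum>m\<in>UNIV. christoffel g m i k' x * du m x)
      + christoffel g l i k' x * du j' x - (\<Sum>m\<in>UNIV. christoffel g m i k' x * g x $ j' $ m) * grad l x" for k' j'
    unfolding chr_diff_def by (rule sum_delta_lower)
  have 3: "(\<Sum>m\<in>UNIV. christoffel g m i j x * g x $ k $ m) = (\<Sum>m\<in>UNIV. christoffel g m i j x * g x $ m $ k)"
    by (simp add: g_sym[OF x, of k])
  show ?thesis
    unfolding 0 2 3 pderiv_du pderiv_g[OF x] cov_grad_def
    unfolding chr_diff_def sum_delta_upper
    by (simp add: algebra_simps)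
qed

text \<open>Adding a tensor D to a connection adds the antisymmetrised covariant derivative of D and
  the commutator of D with itself to the curvature.\<close>

lemma riemann_conformal:
  assumes x: "x \<in> U"
  shows "riemann G l k i j x = riemann g l k i j x
    + ((if l = j then 1 else 0) * hess i k x + (if l = k then 1 else 0) * hess i j x
        - g x $ j $ k * cov_grad i l x)
    - ((if l = i then 1 else 0) * hess j k x + (if l = k then 1 else 0) * hess j i x
        - g x $ i $ k * cov_grad j l x)
    + (\<Sum>m\<in>UNIV. chr_diff l i m x * chr_diff m j k x) - (\<Sum>m\<in>UNIV. chr_diff l j m x * chr_diff m i k x)"
proof -
  have d: "pderiv_vec a (christoffel G l b c) x = pderiv_vec a (christoffel g l b c) x
      + pderiv_vec a (chr_diff l b c) x"
    for a b c
  proof -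
    have "pderiv_vec a (christoffel G l b c) x = pderiv_vec a (\<lambda>y. christoffel g l b c y + chr_diff l b c y) x"
      by (rule pderiv_cong[OF x christoffel_conformal])
    then show ?thesis
      by (simp add: pderiv_vec_add[OF x] smooth_christoffel smooth_chr_diff)
  qed
  \<comment> \<open>Completes the partial derivatives of \<open>chr_diff\<close> to covariant ones:
    the connection term for \<open>i\<close>, \<open>j\<close> enters both and cancels.\<close>
  have s: "(\<Sum>m\<in>UNIV. christoffel g m i j x * chr_diff l k m x)
      = (\<Sum>m\<in>UNIV. christoffel g m j i x * chr_diff l k m x)"
    by (simp add: christoffel_sym[OF x, of _ i j])
  show ?thesis
    unfolding cov_chr_diff[OF x, symmetric] riemann_def d christoffel_conformal[OF x]
    using s by (simp add: sum.distrib sum_subtractf algebra_simps)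
qed

lemma chr_diff_trace: "x \<in> U \<Longrightarrow> (\<Sum>i\<in>UNIV. chr_diff i i m x) = CARD('n) * du m x"
proof -
  assume x: "x \<in> U"
  have "(\<Sum>i\<in>UNIV. chr_diff i i m x) = CARD('n) * du m x + du m x - (\<Sum>i\<in>UNIV. g x $ m $ i * grad i x)"
    unfolding chr_diff_def
    by (simp add: sum.distrib sum_subtractf g_sym[OF x, of m] if_distrib[of "\<lambda>z. z * _"] cong: if_cong)
  then show ?thesis by (simp add: lower_grad[OF x])
qed

lemma chr_diff_sym: "x \<in> U \<Longrightarrow> chr_diff l i j x = chr_diff l j i x"
  by (simp add: chr_diff_def g_sym[of x i j])

lemma ricci_conformal:
  assumes x: "x \<in> U"
  shows "ricci G j k x = ricci g j k x - (real CARD('n) - 2) * (hess j k x - du j x * du k x)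
    - (laplace x + (real CARD('n) - 2) * grad_sq x) * g x $ j $ k"
proof -
  let ?n = "real CARD('n)"
  have du_chr: "(\<Sum>m\<in>UNIV. du m x * chr_diff m j k x) = 2 * du j x * du k x - g x $ j $ k * grad_sq x" for j k
    unfolding chr_diff_def sum_delta_upper grad_sq_def by (simp add: mult.commute)
  have grad_chr: "(\<Sum>m\<in>UNIV. grad m x * (\<Sum>i\<in>UNIV. g x $ k $ i * chr_diff i j m x)) = g x $ j $ k * grad_sq x"
  proof -
    have "(\<Sum>i\<in>UNIV. g x $ k $ i * chr_diff i j m x) = g x $ k $ j * du m x + g x $ k $ m * du j x
        - g x $ j $ m * du k x" for m
      unfolding chr_diff_def sum_delta_upper lower_grad[OF x] ..
    note e = this
    have "(\<Sum>m\<in>UNIV. grad m x * (\<Sum>i\<in>UNIV. g x $ k $ i * chr_diff i j m x)) =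
       g x $ k $ j * grad_sq x + (\<Sum>m\<in>UNIV. g x $ k $ m * grad m x) * du j x
           - (\<Sum>m\<in>UNIV. g x $ j $ m * grad m x) * du k x"
      unfolding grad_sq_def e
      by (simp add: sum.distrib sum_subtractf sum_distrib_left sum_distrib_right algebra_simps)
    then show ?thesis by (simp add: lower_grad[OF x] g_sym[OF x, of k j])
  qed
  \<comment> \<open>Facts 1 and 2 are the traces of the quadratic terms of
    \<open>riemann_conformal\<close>, facts 3 and 4 those of its derivative terms.\<close>
  have 1: "(\<Sum>i\<in>UNIV. \<Sum>m\<in>UNIV. chr_diff i i m x * chr_diff m j k x) = ?n * (2 * du j x * du k x
      - g x $ j $ k * grad_sq x)"
    unfolding du_chr[symmetric]
    by (subst sum.swap) (simp add: sum_distrib_right[symmetric] chr_diff_trace[OF x] sum_distrib_left mult.assoc)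
  have "(\<Sum>m\<in>UNIV. chr_diff i j m x * chr_diff m i k x) =
      chr_diff i j i x * du k x + chr_diff i j k x * du i x
          - g x $ i $ k * (\<Sum>m\<in>UNIV. chr_diff i j m x * grad m x)" for i
    unfolding chr_diff_def[of _ i k] by (rule sum_delta_upper)
  then have "(\<Sum>i\<in>UNIV. \<Sum>m\<in>UNIV. chr_diff i j m x * chr_diff m i k x) =
      (\<Sum>i\<in>UNIV. chr_diff i i j x) * du k x + (\<Sum>i\<in>UNIV. du i x * chr_diff i j k x)
      - (\<Sum>i\<in>UNIV. \<Sum>m\<in>UNIV. grad m x * (g x $ k $ i * chr_diff i j m x))"
    by (simp add: sum.distrib sum_subtractf sum_distrib_left sum_distrib_right chr_diff_sym[OF x, of _ j]
        g_sym[OF x, of k] mult_ac)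
  also have "(\<Sum>i\<in>UNIV. \<Sum>m\<in>UNIV. grad m x * (g x $ k $ i * chr_diff i j m x)) = g x $ j $ k * grad_sq x"
    unfolding grad_chr[symmetric] sum_distrib_left by (rule sum.swap)
  finally have 2: "(\<Sum>i\<in>UNIV. \<Sum>m\<in>UNIV. chr_diff i j m x * chr_diff m i k x) =
      (?n + 2) * du j x * du k x - 2 * g x $ j $ k * grad_sq x"
    by (simp add: chr_diff_trace[OF x] du_chr algebra_simps)
  have "(\<Sum>i\<in>UNIV. (if i = j then 1 else 0) * hess i k x + (if i = k then 1 else 0) * hess i j x
      - g x $ j $ k * cov_grad i i x)
      = hess j k x + hess k j x - g x $ j $ k * laplace x"
    unfolding laplace_def
    by (simp add: sum.distrib sum_subtractf sum_distrib_left if_distrib[of "\<lambda>z. z * _"] cong: if_cong)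
  then have 3: "(\<Sum>i\<in>UNIV. (if i = j then 1 else 0) * hess i k x + (if i = k then 1 else 0) * hess i j x
      - g x $ j $ k * cov_grad i i x)
      = 2 * hess j k x - g x $ j $ k * laplace x"
    using hess_sym[OF x, of k j] by simp
  have "(\<Sum>i\<in>UNIV. (if i = i then 1 else 0) * hess j k x + (if i = k then 1 else 0) * hess j i x
      - g x $ i $ k * cov_grad j i x)
      = ?n * hess j k x + hess j k x - (\<Sum>i\<in>UNIV. g x $ k $ i * cov_grad j i x)"
    by (simp add: sum.distrib sum_subtractf g_sym[OF x, of k] if_distrib[of "\<lambda>z. z * _"] cong: if_cong)
  then have 4: "(\<Sum>i\<in>UNIV. (if i = i then 1 else 0) * hess j k x + (if i = k then 1 else 0) * hess j i x
      - g x $ i $ k * cov_grad j i x)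
      = ?n * hess j k x"
    by (simp add: lower_cov_grad[OF x])
  have "ricci G j k x = ricci g j k x + (2 * hess j k x - g x $ j $ k * laplace x) - ?n * hess j k x
     + ?n * (2 * du j x * du k x - g x $ j $ k * grad_sq x) - ((?n + 2) * du j x * du k x
         - 2 * g x $ j $ k * grad_sq x)"
    unfolding ricci_def riemann_conformal[OF x] sum.distrib[of "\<lambda>i. riemann g i k i j x + _ i - _ i"]
      1[symmetric] 2[symmetric] 3[symmetric] 4[symmetric]
    by (simp only: sum.distrib sum_subtractf)
  then show ?thesis by (simp add: algebra_simps)
qed

lemma scalar_curv_conformal:
  assumes x: "x \<in> U"
  shows "scalar_curv G x = exp (- 2 * u x) *
    (scalar_curv g x - 2 * (real CARD('n) - 1) * laplace x - (real CARD('n) - 1) * (real CARD('n)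
        - 2) * grad_sq x)"
proof -
  let ?n = "real CARD('n)" and ?I = "\<lambda>i j. matrix_inv (g x) $ i $ j"
  have tr: "(\<Sum>j\<in>UNIV. \<Sum>k\<in>UNIV. ?I j k * g x $ j $ k) = ?n"
  proof -
    have "(\<Sum>k\<in>UNIV. ?I j k * g x $ j $ k) = 1" for j
      using g_inv_g[OF x, of j j] by (simp add: g_sym[OF x, of j])
    then show ?thesis by simp
  qed
  have sq: "(\<Sum>j\<in>UNIV. \<Sum>k\<in>UNIV. ?I j k * (du j x * du k x)) = grad_sq x"
    unfolding grad_sq_def grad_def by (simp add: sum_distrib_left sum_distrib_right mult_ac)
  have "scalar_curv G x = exp (- 2 * u x) * (\<Sum>j\<in>UNIV. \<Sum>k\<in>UNIV. ?I j k * ricci G j k x)"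
    unfolding scalar_curv_def G_inv[OF x] by (simp add: sum_distrib_left mult.assoc)
  also have "(\<Sum>j\<in>UNIV. \<Sum>k\<in>UNIV. ?I j k * ricci G j k x) = scalar_curv g x - (?n - 2) * (laplace x - grad_sq x)
     - (laplace x + (?n - 2) * grad_sq x) * ?n"
    unfolding ricci_conformal[OF x] laplace_eq[OF x] sq[symmetric] scalar_curv_def tr[symmetric]
    by (simp add: right_diff_distrib sum_subtractf sum_distrib_left mult.left_commute)
  finally show ?thesis by (simp add: algebra_simps)
qed

end


section \<open>The Cotton--York tensor of a conformal change\<close>

text \<open>Turns the sign of a permutation into a determinant of unit vectors, hence into an
  \<open>area_form\<close>, whose values are already tabulated.\<close>

lemma eps3_det: "eps3 k l m = det (vector [axis k 1, axis l 1, axis m 1] :: real^3^3)"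
proof -
  define \<sigma> where "\<sigma> = (\<lambda>a. (vector [k, l, m] :: 3^3) $ a)"
  have row: "(vector [axis k 1, axis l 1, axis m 1] :: real^3^3) $ i = axis (\<sigma> i) 1" for i
    using exhaust_3[of i] by (auto simp: \<sigma>_def vector_3)
  have "(\<Prod>i\<in>UNIV. axis (\<sigma> i) (1::real) $ p i) = (if p = \<sigma> then 1 else 0)" for p
    by (auto simp: axis_def fun_eq_iff)
  then have "det (vector [axis k 1, axis l 1, axis m 1] :: real^3^3) =
      (\<Sum>p\<in>{p. p permutes UNIV}. of_int (sign p) * (if p = \<sigma> then 1 else 0))"
    by (simp add: det_def row)
  also have "\<dots> = (if \<sigma> permutes UNIV then of_int (sign \<sigma>) else 0)"
    by (simp add: if_distrib[of "\<lambda>z. _ * z"] sum.delta finite_permutations cong: if_cong)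
  finally show ?thesis by (simp add: eps3_def \<sigma>_def Let_def)
qed

lemma sum_eps3:
  fixes r p q :: "3 \<Rightarrow> real"
  shows "(\<Sum>k\<in>UNIV. \<Sum>l\<in>UNIV. \<Sum>m\<in>UNIV. r k * p l * q m * eps3 k l m) =
    r 1 * (p 2 * q 3 - p 3 * q 2) + r 2 * (p 3 * q 1 - p 1 * q 3) + r 3 * (p 1 * q 2 - p 2 * q 1)"
  unfolding eps3_det area_form_def[symmetric] sum_3 area_form_simps
  by (simp add: axis_def algebra_simps)

lemma triple_product_annihilating:
  fixes r p q :: "3 \<Rightarrow> real"
  assumes "(\<Sum>k\<in>UNIV. r k * y $ k) = 0" "(\<Sum>k\<in>UNIV. p k * y $ k) = 0" "(\<Sum>k\<in>UNIV. q k * y $ k) = 0" "y \<noteq> 0"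
  shows "r 1 * (p 2 * q 3 - p 3 * q 2) + r 2 * (p 3 * q 1 - p 1 * q 3) + r 3 * (p 1 * q 2 - p 2 * q 1) = 0"
    (is "?D = 0")
proof -
  \<comment> \<open>Cramer's rule: the determinant times a component of \<open>y\<close> is a
    combination of the three vanishing contractions.\<close>
  have "?D * y $ 1 = 0" "?D * y $ 2 = 0" "?D * y $ 3 = 0"
    using assms(1-3) unfolding sum_3 by algebra+
  moreover have "y $ 1 \<noteq> 0 \<or> y $ 2 \<noteq> 0 \<or> y $ 3 \<noteq> 0"
    using assms(4) by (auto simp: vec_eq_iff forall_3)
  ultimately show ?thesis by auto
qed

locale conformal_parallel_3 = parallel_field_3 U g Y + conformal_change U g u G
  for U :: "(real^3) set" and g Y u G
begin

definition schouten_expr :: "3 \<Rightarrow> 3 \<Rightarrow> real^3 \<Rightarrow> real" where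
  "schouten_expr j k x = rho x * (Y_sq x / 2 * g x $ j $ k - Y_low j x * Y_low k x)
     - hess j k x + du j x * du k x - grad_sq x / 2 * g x $ j $ k"

text \<open>The Laplacian cancels between the Ricci tensor and the scalar curvature, which leaves
  the Schouten tensor of \<open>g\<close> and terms in the gradient and Hessian of
  \<open>u\<close>.\<close>

lemma schouten_conformal:
  assumes x: "x \<in> U"
  shows "schouten G j k x = schouten_expr j k x"
proof -
  have s: "scalar_curv g x = 2 * Y_sq x * rho x"
    using Y_sq_nonzero[OF x] by (simp add: rho_def)
  have "scalar_curv G x / 4 * G x $ j $ k =
      (scalar_curv g x - 4 * laplace x - 2 * grad_sq x) / 4 * g x $ j $ k"
    unfolding scalar_curv_conformal[OF x] by (simp add: G_eq[OF x] exp_minus field_simps)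
  then show ?thesis
    unfolding schouten_def ricci_conformal[OF x] ricci_structure[OF x] schouten_expr_def s
    by (simp add: field_simps)
qed

lemma schouten_expr_sym: "x \<in> U \<Longrightarrow> schouten_expr j k x = schouten_expr k j x"
  by (simp add: schouten_expr_def g_sym[of x j k] hess_sym[of x j k])

lemma pderiv_schouten_expr:
  assumes x: "x \<in> U"
  shows "pderiv_vec i (schouten_expr j k) x =
      pderiv_vec i rho x * (Y_sq x / 2 * g x $ j $ k - Y_low j x * Y_low k x)
      + rho x * (Y_sq x / 2 * pderiv_vec i (\<lambda>y. g y $ j $ k) x
         - pderiv_vec i (Y_low j) x * Y_low k x - Y_low j x * pderiv_vec i (Y_low k) x)
      - pderiv_vec i (hess j k) x + pderiv_vec i (du j) x * du k x + du j x * pderiv_vec i (du k) x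
      - pderiv_vec i grad_sq x / 2 * g x $ j $ k - grad_sq x / 2 * pderiv_vec i (\<lambda>y. g y $ j $ k) x"
proof -
  have e: "schouten_expr j k = (\<lambda>x. rho x * (1/2 * Y_sq x * g x $ j $ k - Y_low j x * Y_low k x)
     - hess j k x + du j x * du k x - 1/2 * grad_sq x * g x $ j $ k)"
    by (simp add: schouten_expr_def fun_eq_iff)
  note sm = smooth_rules smooth_rho smooth_Y_sq smooth_Y_low smooth_hess smooth_u smooth_grad_sq
  show ?thesis
    unfolding e
    by (simp only: x pderiv_rules sm pderiv_Y_sq[OF x]) (simp add: algebra_simps)
qed

text \<open>The antisymmetrised derivative with respect to the connection of \<open>g\<close> alone.
  The third derivatives of \<open>u\<close> combine to curvature by \<open>ricci_identity\<close>;
  everything else follows the Leibniz rule with parallel metric and \<open>Y_low\<close>.\<close>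

lemma cov_schouten_expr:
  assumes x: "x \<in> U"
  shows "(pderiv_vec i (schouten_expr j k) x - (\<Sum>m\<in>UNIV. christoffel g m i k x * schouten_expr j m x))
       - (pderiv_vec j (schouten_expr i k) x - (\<Sum>m\<in>UNIV. christoffel g m j k x * schouten_expr i m x)) =
      pderiv_vec i rho x * (Y_sq x / 2 * g x $ j $ k - Y_low j x * Y_low k x)
      - pderiv_vec j rho x * (Y_sq x / 2 * g x $ i $ k - Y_low i x * Y_low k x)
      + (\<Sum>m\<in>UNIV. grad m x * riemann_low m k i j x)
      + du j x * hess i k x - du i x * hess j k x
      - (\<Sum>m\<in>UNIV. grad m x * hess i m x) * g x $ j $ k + (\<Sum>m\<in>UNIV. grad m x * hess j m x) * g x $ i $ k"
proof -
  \<comment> \<open>The contractions with Christoffel symbols become atoms, so that the final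
    cancellation is pure polynomial algebra.\<close>
  define Cg where "Cg = (\<lambda>i j k. \<Sum>m\<in>UNIV. christoffel g m i j x * g x $ m $ k)"
  define CY where "CY = (\<lambda>i j. \<Sum>m\<in>UNIV. christoffel g m i j x * Y_low m x)"
  define Cu where "Cu = (\<lambda>i j. \<Sum>m\<in>UNIV. christoffel g m i j x * du m x)"
  define Ch where "Ch = (\<lambda>i k j. \<Sum>m\<in>UNIV. christoffel g m i k x * hess j m x)"
  have dg: "pderiv_vec i (\<lambda>y. g y $ j $ k) x = Cg i j k + Cg i k j" for i j k
    unfolding pderiv_g[OF x] Cg_def by (simp add: g_sym[OF x, of j])
  have dY: "pderiv_vec i (Y_low j) x = CY i j" for i j
    unfolding CY_def by (rule pderiv_Y_low[OF x])
  have dd: "pderiv_vec i (du j) x = hess i j x + Cu i j" for i j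
    unfolding Cu_def by (rule pderiv_du)
  have sum: "(\<Sum>m\<in>UNIV. christoffel g m i k x * schouten_expr j m x) =
     rho x * (Y_sq x / 2 * Cg i k j - Y_low j x * CY i k) - Ch i k j + du j x * Cu i k
         - grad_sq x / 2 * Cg i k j" for i j k
    unfolding schouten_expr_def Cg_def CY_def Cu_def Ch_def
    by (simp add: sum.distrib sum_subtractf sum_distrib_left algebra_simps g_sym[OF x, of j])
  have sym: "Cg i j k = Cg j i k" "CY i j = CY j i" "Cu i j = Cu j i"
    unfolding Cg_def CY_def Cu_def by (simp_all add: christoffel_sym[OF x, of _ i j])
  have "(pderiv_vec i (hess j k) x - Ch i k j) - (pderiv_vec j (hess i k) x - Ch j k i) =
     - (\<Sum>l\<in>UNIV. riemann g l k i j x * du l x)"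
    unfolding Ch_def hess_def by (rule ricci_identity[OF x smooth_du])
  also have "(\<Sum>l\<in>UNIV. riemann g l k i j x * du l x)
      = (\<Sum>l\<in>UNIV. \<Sum>m\<in>UNIV. grad m x * (g x $ m $ l * riemann g l k i j x))"
    unfolding lower_grad[OF x, symmetric] sum_distrib_left
  proof (intro sum.cong refl)
    fix l m
    show "riemann g l k i j x * (g x $ l $ m * grad m x) = grad m x * (g x $ m $ l * riemann g l k i j x)"
      using g_sym[OF x, of l m] by simp
  qed
  also have "\<dots> = (\<Sum>m\<in>UNIV. grad m x * riemann_low m k i j x)"
    unfolding riemann_low_def sum_distrib_left by (rule sum.swap)
  finally show ?thesis
    unfolding pderiv_schouten_expr[OF x] sum dg dY dd pderiv_grad_sq[OF x]
    using sym hess_sym[OF x, of i j]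
    by (simp add: algebra_simps)
qed

text \<open>In dimension three the Cotton tensor is conformally invariant; here it equals the Cotton tensor of
  \<open>g\<close>, whose Schouten tensor is \<open>\<rho> (|Y|\<^sup>2 g / 2 - Y \<otimes> Y)\<close>.\<close>

lemma cotton_conformal:
  assumes x: "x \<in> U"
  shows "cotton G i j k x =
      pderiv_vec i rho x * (Y_sq x / 2 * g x $ j $ k - Y_low j x * Y_low k x)
      - pderiv_vec j rho x * (Y_sq x / 2 * g x $ i $ k - Y_low i x * Y_low k x)"
proof -
  define Hw where "Hw j = (\<Sum>m\<in>UNIV. grad m x * hess j m x)" for j
  define Yw where "Yw = (\<Sum>m\<in>UNIV. grad m x * Y_low m x)"
  have gw: "(\<Sum>m\<in>UNIV. grad m x * g x $ m $ j) = du j x" for j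
    using lower_grad[OF x, of j] by (simp add: g_sym[OF x, of j] mult.commute)
  have wP: "(\<Sum>m\<in>UNIV. schouten_expr j m x * grad m x) =
      rho x * (Y_sq x / 2 * du j x - Y_low j x * Yw) - Hw j + du j x * grad_sq x - grad_sq x / 2 * du j x" for j
  proof -
    have "(\<Sum>m\<in>UNIV. schouten_expr j m x * grad m x) =
      rho x * (Y_sq x / 2 * (\<Sum>m\<in>UNIV. g x $ j $ m * grad m x) - Y_low j x * Yw) - Hw j
      + du j x * (\<Sum>m\<in>UNIV. grad m x * du m x) - grad_sq x / 2 * (\<Sum>m\<in>UNIV. g x $ j $ m * grad m x)"
      unfolding schouten_expr_def Yw_def Hw_def by (simp add: sum_3 algebra_simps)
    then show ?thesis by (simp only: lower_grad[OF x] grad_sq_def[symmetric])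
  qed
  \<comment> \<open>In general the Cotton tensor changes by the gradient contracted into the Weyl
    tensor. Here the explicit curvature lets this term cancel against those with
    \<open>chr_diff\<close>.\<close>
  have wR: "(\<Sum>m\<in>UNIV. grad m x * riemann_low m k i j x) =
     rho x * (Y_sq x * (du i x * g x $ k $ j - du j x * g x $ k $ i)
      - du i x * Y_low k x * Y_low j x - Yw * Y_low i x * g x $ k $ j
      + du j x * Y_low k x * Y_low i x + Yw * Y_low j x * g x $ k $ i)"
    unfolding curvature_structure[OF x] gw[symmetric] Yw_def
    by (simp add: sum_3 algebra_simps)
  have dS: "pderiv_vec i (schouten G j k) x = pderiv_vec i (schouten_expr j k) x" for i j k
    by (rule pderiv_cong[OF x schouten_conformal])
  have chr: "(\<Sum>m\<in>UNIV. schouten_expr j m x * chr_diff m i k x) =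
      schouten_expr j i x * du k x + schouten_expr j k x * du i x
      - g x $ i $ k * (\<Sum>m\<in>UNIV. schouten_expr j m x * grad m x)" for i j k
    unfolding chr_diff_def by (rule sum_delta_upper)
  have cs: "christoffel G m i j x = christoffel G m j i x" for m
    by (simp add: christoffel_conformal[OF x] christoffel_sym[OF x, of _ i j] chr_diff_sym[OF x, of _ i j])
  have chr': "(\<Sum>m\<in>UNIV. christoffel G m i k x * schouten_expr j m x) =
      (\<Sum>m\<in>UNIV. christoffel g m i k x * schouten_expr j m x)
      + (\<Sum>m\<in>UNIV. schouten_expr j m x * chr_diff m i k x)" for i j k
    unfolding christoffel_conformal[OF x] by (simp add: distrib_left distrib_right sum.distrib mult.commute)
  have "cotton G i j k x =
      (pderiv_vec i (schouten_expr j k) x - (\<Sum>m\<in>UNIV. christoffel G m i k x * schouten_expr j m x))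
      - (pderiv_vec j (schouten_expr i k) x - (\<Sum>m\<in>UNIV. christoffel G m j k x * schouten_expr i m x))"
    unfolding cotton_def covariant_deriv_02_def dS schouten_conformal[OF x] by (simp add: cs)
  also have "\<dots> = pderiv_vec i rho x * (Y_sq x / 2 * g x $ j $ k - Y_low j x * Y_low k x)
      - pderiv_vec j rho x * (Y_sq x / 2 * g x $ i $ k - Y_low i x * Y_low k x)
      + (\<Sum>m\<in>UNIV. grad m x * riemann_low m k i j x)
      + du j x * hess i k x - du i x * hess j k x
      - Hw i * g x $ j $ k + Hw j * g x $ i $ k
      - (\<Sum>m\<in>UNIV. schouten_expr j m x * chr_diff m i k x)
      + (\<Sum>m\<in>UNIV. schouten_expr i m x * chr_diff m j k x)"
    unfolding chr' Hw_def using cov_schouten_expr[OF x, of i j k] by linarith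
  also have "\<dots> = pderiv_vec i rho x * (Y_sq x / 2 * g x $ j $ k - Y_low j x * Y_low k x)
      - pderiv_vec j rho x * (Y_sq x / 2 * g x $ i $ k - Y_low i x * Y_low k x)"
    unfolding wR chr wP schouten_expr_sym[OF x, of j i]
    unfolding schouten_expr_def g_sym[OF x, of k j] g_sym[OF x, of k i]
    by (simp add: field_simps)
  finally show ?thesis .
qed

text \<open>The two halves of the antisymmetric Cotton tensor contribute equally against
  \<open>eps3\<close>, which uses up the factor 1/2. The exponential comes from lowering the index
  of \<open>w'\<close> with \<open>G\<close> instead of \<open>g\<close>.\<close>

lemma cotton_york_form:
  assumes x: "x \<in> U"
  defines "b \<equiv> \<lambda>w k. \<Sum>i\<in>UNIV. g x $ k $ i * w $ i"
  shows "(\<Sum>i\<in>UNIV. \<Sum>j\<in>UNIV. cotton_york_coeff G i j x * w $ i * w' $ j) =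
    exp (2 * u x) / sqrt (det (G x)) *
    (\<Sum>k\<in>UNIV. \<Sum>l\<in>UNIV. \<Sum>m\<in>UNIV. pderiv_vec k rho x *
       (Y_sq x / 2 * b w l - Y_low l x * (\<Sum>i\<in>UNIV. Y_low i x * w $ i)) * b w' m * eps3 k l m)"
proof -
  have anti: "eps3 k l m = - eps3 l k m" for k l m
    unfolding eps3_det area_form_def[symmetric]
    using exhaust_3[of k] exhaust_3[of l] by (elim disjE) (simp_all add: area_form_simps)
  define p where "p l = Y_sq x / 2 * b w l - Y_low l x * (\<Sum>i\<in>UNIV. Y_low i x * w $ i)" for l
  define D where "D = exp (2 * u x) / sqrt (det (G x))"
  define r where "r k = pderiv_vec k rho x" for k
  have C: "(\<Sum>i\<in>UNIV. cotton G k l i x * w $ i) = r k * p l - r l * p k" for k l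
    unfolding cotton_conformal[OF x] p_def b_def r_def
    by (simp add: sum_3 algebra_simps)
  have B: "(\<Sum>j\<in>UNIV. G x $ j $ m * w' $ j) = exp (2 * u x) * b w' m" for m
    unfolding b_def by (simp add: G_eq[OF x] sum_distrib_left g_sym[OF x, of m] mult.assoc)
  have "(\<Sum>i\<in>UNIV. \<Sum>j\<in>UNIV. cotton_york_coeff G i j x * w $ i * w' $ j) =
    1/2 * (\<Sum>k\<in>UNIV. \<Sum>l\<in>UNIV. \<Sum>m\<in>UNIV. (\<Sum>i\<in>UNIV. cotton G k l i x * w $ i)
      * (\<Sum>j\<in>UNIV. G x $ j $ m * w' $ j) * (eps3 k l m / sqrt (det (G x))))"
  proof -
    have swap: "(\<Sum>i\<in>UNIV. \<Sum>j\<in>UNIV. (\<Sum>k\<in>UNIV. \<Sum>l\<in>UNIV. \<Sum>m\<in>UNIV. f k l i * h j m * e k l m) * w $ i * w' $ j) =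
      (\<Sum>k\<in>UNIV. \<Sum>l\<in>UNIV. \<Sum>m\<in>UNIV. (\<Sum>i\<in>UNIV. f k l i * w $ i) * (\<Sum>j\<in>UNIV. h j m * w' $ j) * e k l m)"
      for f :: "3 \<Rightarrow> 3 \<Rightarrow> 3 \<Rightarrow> real" and h and e :: "3 \<Rightarrow> 3 \<Rightarrow> 3 \<Rightarrow> real"
    proof -
      have sk: "(\<Sum>i\<in>UNIV. \<Sum>j\<in>UNIV. \<Sum>k\<in>UNIV. F i j k) = (\<Sum>k\<in>UNIV. \<Sum>i\<in>UNIV. \<Sum>j\<in>UNIV. F i j k)"
        for F :: "3 \<Rightarrow> 3 \<Rightarrow> 3 \<Rightarrow> real"
      proof -
        have "(\<Sum>i\<in>UNIV. \<Sum>j\<in>UNIV. \<Sum>k\<in>UNIV. F i j k) = (\<Sum>i\<in>UNIV. \<Sum>k\<in>UNIV. \<Sum>j\<in>UNIV. F i j k)"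
          by (intro sum.cong refl sum.swap)
        then show ?thesis by (simp only: sum.swap[of "\<lambda>i k. \<Sum>j\<in>UNIV. F i j k"])
      qed
      have "(\<Sum>i\<in>UNIV. \<Sum>j\<in>UNIV. (\<Sum>k\<in>UNIV. \<Sum>l\<in>UNIV. \<Sum>m\<in>UNIV. f k l i * h j m * e k l m) * w $ i * w' $ j) =
        (\<Sum>i\<in>UNIV. \<Sum>j\<in>UNIV. \<Sum>k\<in>UNIV. \<Sum>l\<in>UNIV. \<Sum>m\<in>UNIV. f k l i * h j m * e k l m * w $ i * w' $ j)"
        by (simp only: sum_distrib_right)
      also have "\<dots> = (\<Sum>k\<in>UNIV. \<Sum>i\<in>UNIV. \<Sum>j\<in>UNIV. \<Sum>l\<in>UNIV. \<Sum>m\<in>UNIV. f k l i * h j m * e k l m * w $ i * w' $ j)"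
        by (rule sk)
      also have "\<dots> = (\<Sum>k\<in>UNIV. \<Sum>l\<in>UNIV. \<Sum>i\<in>UNIV. \<Sum>j\<in>UNIV. \<Sum>m\<in>UNIV. f k l i * h j m * e k l m * w $ i * w' $ j)"
        by (rule sum.cong[OF refl], rule sk)
      also have "\<dots> = (\<Sum>k\<in>UNIV. \<Sum>l\<in>UNIV. \<Sum>m\<in>UNIV. \<Sum>i\<in>UNIV. \<Sum>j\<in>UNIV. f k l i * h j m * e k l m * w $ i * w' $ j)"
        by (rule sum.cong[OF refl], rule sum.cong[OF refl], rule sk)
      finally have "(\<Sum>i\<in>UNIV. \<Sum>j\<in>UNIV. (\<Sum>k\<in>UNIV. \<Sum>l\<in>UNIV. \<Sum>m\<in>UNIV. f k l i * h j m * e k l m) * w $ i * w' $ j) =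
        (\<Sum>k\<in>UNIV. \<Sum>l\<in>UNIV. \<Sum>m\<in>UNIV. \<Sum>i\<in>UNIV. \<Sum>j\<in>UNIV. f k l i * h j m * e k l m * w $ i * w' $ j)" .
      moreover have "(\<Sum>i\<in>UNIV. \<Sum>j\<in>UNIV. f k l i * h j m * e k l m * w $ i * w' $ j) =
        (\<Sum>i\<in>UNIV. f k l i * w $ i) * (\<Sum>j\<in>UNIV. h j m * w' $ j) * e k l m" for k l m
        by (simp add: sum_distrib_left sum_distrib_right mult_ac)
      ultimately show ?thesis by (simp only:)
    qed
    have half: "(\<Sum>i\<in>UNIV. \<Sum>j\<in>UNIV. (1/2 * K i j) * w $ i * w' $ j)
        = 1/2 * (\<Sum>i\<in>UNIV. \<Sum>j\<in>UNIV. K i j * w $ i * w' $ j)"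
      for K :: "3 \<Rightarrow> 3 \<Rightarrow> real"
      by (simp only: sum_distrib_left mult.assoc)
    show ?thesis
      unfolding cotton_york_coeff_def half swap ..
  qed
  also have "\<dots> = D * (1/2 * ((\<Sum>k\<in>UNIV. \<Sum>l\<in>UNIV. \<Sum>m\<in>UNIV. r k * p l * b w' m * eps3 k l m)
     - (\<Sum>k\<in>UNIV. \<Sum>l\<in>UNIV. \<Sum>m\<in>UNIV. r l * p k * b w' m * eps3 k l m)))"
    unfolding C B D_def by (simp add: sum_distrib_left sum_subtractf[symmetric] algebra_simps diff_divide_distrib)
  also have "(\<Sum>k\<in>UNIV. \<Sum>l\<in>UNIV. \<Sum>m\<in>UNIV. r l * p k * b w' m * eps3 k l m) =
      - (\<Sum>k\<in>UNIV. \<Sum>l\<in>UNIV. \<Sum>m\<in>UNIV. r k * p l * b w' m * eps3 k l m)"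
  proof -
    have "(\<Sum>k\<in>UNIV. \<Sum>l\<in>UNIV. \<Sum>m\<in>UNIV. r l * p k * b w' m * eps3 k l m) =
      (\<Sum>k\<in>UNIV. \<Sum>l\<in>UNIV. \<Sum>m\<in>UNIV. r k * p l * b w' m * eps3 l k m)"
      by (rule sum.swap)
    also have "\<dots> = (\<Sum>k\<in>UNIV. \<Sum>l\<in>UNIV. \<Sum>m\<in>UNIV. - (r k * p l * b w' m * eps3 k l m))"
    proof (intro sum.cong refl)
      fix k l m
      show "r k * p l * b w' m * eps3 l k m = - (r k * p l * b w' m * eps3 k l m)"
        using anti[of l k m] by simp
    qed
    finally show ?thesis by (simp add: sum_negf)
  qed
  finally show ?thesis by (simp add: D_def p_def r_def)
qed

theorem cotton_york_parallel:
  assumes x: "x \<in> U"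
  shows "(\<Sum>i\<in>UNIV. \<Sum>j\<in>UNIV. cotton_york_coeff G i j x * Y x $ i * Y x $ j) = 0"
    and "(\<Sum>i\<in>UNIV. \<Sum>j\<in>UNIV. G x $ i $ j * Y x $ i * w $ j) = 0 \<Longrightarrow>
      (\<Sum>i\<in>UNIV. \<Sum>j\<in>UNIV. G x $ i $ j * Y x $ i * w' $ j) = 0 \<Longrightarrow>
      (\<Sum>i\<in>UNIV. \<Sum>j\<in>UNIV. cotton_york_coeff G i j x * w $ i * w' $ j) = 0"
proof -
  \<comment> \<open>For the pair \<open>Y\<close>, \<open>Y\<close> the last two covectors of the
    triple product are both multiples of \<open>Y_low\<close>.\<close>
  show "(\<Sum>i\<in>UNIV. \<Sum>j\<in>UNIV. cotton_york_coeff G i j x * Y x $ i * Y x $ j) = 0"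
    unfolding cotton_york_form[OF x] sum_eps3 Y_low_def[symmetric] Y_sq_def[symmetric]
    by (simp add: algebra_simps)
next
  have Y0: "Y x \<noteq> 0" using Y_sq_nonzero[OF x] by (auto simp: Y_sq_def)
  \<comment> \<open>Orthogonality to \<open>Y\<close> is the same for the conformal metrics
    \<open>G\<close> and \<open>g\<close>.\<close>
  have orth: "(\<Sum>i\<in>UNIV. Y_low i x * w $ i) = 0" "(\<Sum>k\<in>UNIV. (\<Sum>i\<in>UNIV. g x $ k $ i * w $ i) * Y x $ k) = 0"
    if "(\<Sum>i\<in>UNIV. \<Sum>j\<in>UNIV. G x $ i $ j * Y x $ i * w $ j) = 0" for w
  proof -
    have "exp (2 * u x) * (\<Sum>i\<in>UNIV. \<Sum>j\<in>UNIV. g x $ i $ j * Y x $ i * w $ j) = 0"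
      using that by (simp add: G_eq[OF x] sum_distrib_left mult.assoc)
    then have 0: "(\<Sum>i\<in>UNIV. \<Sum>j\<in>UNIV. g x $ i $ j * Y x $ i * w $ j) = 0" by simp
    then show "(\<Sum>k\<in>UNIV. (\<Sum>i\<in>UNIV. g x $ k $ i * w $ i) * Y x $ k) = 0"
      by (simp add: sum_distrib_left sum_distrib_right mult_ac)
    show "(\<Sum>i\<in>UNIV. Y_low i x * w $ i) = 0"
      using 0 g_sym[OF x, of 1 2] g_sym[OF x, of 1 3] g_sym[OF x, of 2 3]
      by (simp add: Y_low_def sum_3 algebra_simps)
  qed
  assume w: "(\<Sum>i\<in>UNIV. \<Sum>j\<in>UNIV. G x $ i $ j * Y x $ i * w $ j) = 0"
    and w': "(\<Sum>i\<in>UNIV. \<Sum>j\<in>UNIV. G x $ i $ j * Y x $ i * w' $ j) = 0"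
  have "(\<Sum>k\<in>UNIV. pderiv_vec k rho x * Y x $ k) = 0"
    using Y_rho[OF x] by (simp add: mult.commute)
  \<comment> \<open>The literal 0 is the contraction of \<open>Y_low\<close> with \<open>w\<close>,
    as it stands after unfolding \<open>orth(1)\<close>.\<close>
  moreover have "(\<Sum>k\<in>UNIV. (Y_sq x / 2 * (\<Sum>i\<in>UNIV. g x $ k $ i * w $ i) - Y_low k x * 0) * Y x $ k) = 0"
  proof -
    have "(\<Sum>k\<in>UNIV. (c * B k - Y_low k x * 0) * Y x $ k) = c * (\<Sum>k\<in>UNIV. B k * Y x $ k)" for c B
      by (simp add: sum_distrib_left mult.assoc)
    then show ?thesis by (simp only: orth(2)[OF w] mult_zero_right)
  qed
  ultimately show "(\<Sum>i\<in>UNIV. \<Sum>j\<in>UNIV. cotton_york_coeff G i j x * w $ i * w' $ j) = 0"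
    unfolding cotton_york_form[OF x] orth(1)[OF w] sum_eps3
    by (subst triple_product_annihilating[OF _ _ orth(2)[OF w'] Y0]) simp_all
qed

end


section \<open>Tangent vectors and metrics in a chart\<close>

lemma chart_inj_on: "is_chart M c \<Longrightarrow> inj_on (chart_map c) (chart_dom c)"
proof -
  assume c: "is_chart M c"
  then have "topspace (subtopology M (chart_dom c)) = chart_dom c"
    by (auto simp: is_chart_def dest: openin_subset)
  with c show ?thesis
    by (metis homeomorphic_imp_injective_map is_chart_def)
qed

lemma chart_inv_map: "is_chart M c \<Longrightarrow> p \<in> chart_dom c \<Longrightarrow> chart_inv c (chart_map c p) = p"
  by (simp add: chart_inv_def chart_inj_on)

lemma chart_map_inv:
  "y \<in> chart_image c \<Longrightarrow> chart_inv c y \<in> chart_dom c \<and> chart_map c (chart_inv c y) = y"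
  unfolding chart_image_def chart_inv_def by (simp add: inv_into_into f_inv_into_f)

locale manifold =
  fixes M :: "'a topology" and A :: "('a, 'n::finite) chart set"
  assumes manifold: "smooth_manifold M A"
begin

lemma is_chart: "c \<in> A \<Longrightarrow> is_chart M c"
  using manifold by (simp add: smooth_manifold_def)

lemma open_chart_image: "c \<in> A \<Longrightarrow> open (chart_image c)"
  using is_chart by (simp add: is_chart_def)

lemma chart_dom_subset: "c \<in> A \<Longrightarrow> chart_dom c \<subseteq> topspace M"
  using is_chart by (simp add: is_chart_def openin_subset)

lemma open_overlap:
  assumes "c \<in> A" "c' \<in> A"
  shows "open (chart_map c ` (chart_dom c \<inter> chart_dom c'))"
proof -
  have o: "openin M (chart_dom c)" "openin M (chart_dom c')"
    using assms is_chart by (auto simp: is_chart_def)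
  have "open_map (subtopology M (chart_dom c)) (top_of_set (chart_image c)) (chart_map c)"
    using is_chart[OF assms(1)] by (simp add: is_chart_def homeomorphic_imp_open_map)
  moreover have "openin (subtopology M (chart_dom c)) (chart_dom c \<inter> chart_dom c')"
    using o by (metis inf.commute openin_subtopology_Int)
  ultimately have "openin (top_of_set (chart_image c)) (chart_map c ` (chart_dom c \<inter> chart_dom c'))"
    by (simp add: open_map_def)
  then show ?thesis
    using open_chart_image[OF assms(1)] openin_open_eq by blast
qed

section \<open>Jacobians of coordinate changes\<close>

abbreviation jac :: "('a, 'n) chart \<Rightarrow> ('a, 'n) chart \<Rightarrow> 'a \<Rightarrow> real^'n \<Rightarrow> real^'n" where
  "jac c c' p \<equiv> frechet_derivative (transition c c') (at (chart_map c p))"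

lemma has_derivative_transition:
  assumes "c \<in> A" "c' \<in> A" "p \<in> chart_dom c" "p \<in> chart_dom c'"
  shows "(transition c c' has_derivative jac c c' p) (at (chart_map c p))"
proof -
  have "smooth_on (transition c c') (chart_map c ` (chart_dom c \<inter> chart_dom c'))"
    using manifold assms by (simp add: smooth_manifold_def)
  then show ?thesis
    using assms by (intro has_derivative_frechet smooth_on_imp_differentiable) auto
qed

lemma linear_jac:
  "c \<in> A \<Longrightarrow> c' \<in> A \<Longrightarrow> p \<in> chart_dom c \<Longrightarrow> p \<in> chart_dom c' \<Longrightarrow> linear (jac c c' p)"
  by (rule has_derivative_linear[OF has_derivative_transition])

lemma jac_self:
  assumes "c \<in> A" "p \<in> chart_dom c"
  shows "jac c c p = id"
proof -
  have "jac c c p = frechet_derivative id (at (chart_map c p))"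
  proof (rule frechet_derivative_cong_open[OF open_chart_image[OF assms(1)]])
    show "chart_map c p \<in> chart_image c" using assms by (simp add: chart_image_def)
    show "transition c c y = id y" if "y \<in> chart_image c" for y
      using chart_map_inv[OF that] by (simp add: transition_def)
  qed
  then show ?thesis by (simp add: frechet_derivative_id)
qed

text \<open>The chain rule. The transition maps compose as expected only over the overlap, whose
  image is open, so the derivative does not notice.\<close>

lemma jac_compose:
  assumes c: "c \<in> A" "c' \<in> A" "c'' \<in> A" and p: "p \<in> chart_dom c" "p \<in> chart_dom c'" "p \<in> chart_dom c''"
  shows "jac c c'' p = jac c' c'' p \<circ> jac c c' p"
proof -
  have t: "transition c c' (chart_map c p) = chart_map c' p"
    using chart_inv_map[OF is_chart[OF c(1)] p(1)] by (simp add: transition_def)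
  have D: "(transition c' c'' \<circ> transition c c' has_derivative jac c' c'' p \<circ> jac c c' p) (at (chart_map c p))"
    using has_derivative_transition[OF c(2,3) p(2,3)]
    by (intro diff_chain_at has_derivative_transition c p) (simp add: t)
  have eq: "(transition c' c'' \<circ> transition c c') y = transition c c'' y"
    if "y \<in> chart_map c ` (chart_dom c \<inter> chart_dom c')" for y
    using that chart_inv_map[OF is_chart[OF c(1)]] chart_inv_map[OF is_chart[OF c(2)]]
    by (auto simp: transition_def)
  have "chart_map c p \<in> chart_map c ` (chart_dom c \<inter> chart_dom c')"
    using p by blast
  from has_derivative_transform_within_open[OF D open_overlap[OF c(1,2)] this eq]
  have "(transition c c'' has_derivative jac c' c'' p \<circ> jac c c' p) (at (chart_map c p))" .
  from frechet_derivative_at[OF this] show ?thesis ..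
qed

section \<open>Tangent vectors and their components\<close>

lemma tangent_spaceI:
  assumes "\<And>c c'. c \<in> A \<Longrightarrow> c' \<in> A \<Longrightarrow> p \<in> chart_dom c \<Longrightarrow> p \<in> chart_dom c' \<Longrightarrow> v c' = jac c c' p (v c)"
    and "\<And>c. \<not> (c \<in> A \<and> p \<in> chart_dom c) \<Longrightarrow> v c = 0"
  shows "v \<in> tangent_space A p"
  using assms unfolding tangent_space_def by blast

lemma tangent_spaceD:
  assumes "v \<in> tangent_space A p"
  shows "c \<in> A \<Longrightarrow> c' \<in> A \<Longrightarrow> p \<in> chart_dom c \<Longrightarrow> p \<in> chart_dom c' \<Longrightarrow> v c' = jac c c' p (v c)"
    and "\<not> (c \<in> A \<and> p \<in> chart_dom c) \<Longrightarrow> v c = 0"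
  using assms unfolding tangent_space_def by blast+

lemma tangent_space_add:
  assumes v: "v \<in> tangent_space A p" and w: "w \<in> tangent_space A p"
  shows "tangent_add v w \<in> tangent_space A p"
proof (rule tangent_spaceI)
  fix c c' assume c: "c \<in> A" "c' \<in> A" "p \<in> chart_dom c" "p \<in> chart_dom c'"
  show "tangent_add v w c' = jac c c' p (tangent_add v w c)"
    unfolding tangent_add_def linear_add[OF linear_jac[OF c]] tangent_spaceD(1)[OF v c] tangent_spaceD(1)[OF w c] ..
qed (use tangent_spaceD(2)[OF v] tangent_spaceD(2)[OF w] in \<open>simp add: tangent_add_def\<close>)

lemma tangent_space_scale:
  assumes v: "v \<in> tangent_space A p"
  shows "tangent_scale a v \<in> tangent_space A p"
proof (rule tangent_spaceI)
  fix c c' assume c: "c \<in> A" "c' \<in> A" "p \<in> chart_dom c" "p \<in> chart_dom c'"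
  show "tangent_scale a v c' = jac c c' p (tangent_scale a v c)"
    unfolding tangent_scale_def linear_cmul[OF linear_jac[OF c]] tangent_spaceD(1)[OF v c] ..
qed (use tangent_spaceD(2)[OF v] in \<open>simp add: tangent_scale_def\<close>)

lemma tangent_space_zero: "tangent_zero \<in> tangent_space A p"
  by (rule tangent_spaceI) (simp_all add: tangent_zero_def linear_0[OF linear_jac])

lemma coord_vector_tangent:
  assumes "c \<in> A" "p \<in> chart_dom c"
  shows "coord_vector A c i p \<in> tangent_space A p"
proof (rule tangent_spaceI)
  fix c1 c2 assume "c1 \<in> A" "c2 \<in> A" "p \<in> chart_dom c1" "p \<in> chart_dom c2"
  then show "coord_vector A c i p c2 = jac c1 c2 p (coord_vector A c i p c1)"
    using jac_compose[OF assms(1) _ _ assms(2), of c1 c2] by (simp add: coord_vector_def)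
qed (auto simp: coord_vector_def)

text \<open>The vector with components \<open>a\<close> in the chart \<open>c\<close>, restricted to
  the indices in \<open>I\<close>: additivity of the metric is given for two tangent vectors at a
  time, and induction on \<open>I\<close> extends it to the whole sum.\<close>

definition tangent_of :: "('a, 'n) chart \<Rightarrow> 'a \<Rightarrow> 'n set \<Rightarrow> real^'n \<Rightarrow> ('a, 'n) tangent" where
  "tangent_of c p I a = (\<lambda>c'. \<Sum>i\<in>I. a $ i *\<^sub>R coord_vector A c i p c')"

lemma tangent_of_insert:
  "i \<notin> I \<Longrightarrow> tangent_of c p (insert i I) a =
    tangent_add (tangent_scale (a $ i) (coord_vector A c i p)) (tangent_of c p I a)"
  by (simp add: tangent_of_def tangent_add_def tangent_scale_def)

lemma tangent_of_tangent:
  assumes "c \<in> A" "p \<in> chart_dom c"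
  shows "tangent_of c p I a \<in> tangent_space A p"
proof -
  have "finite I" by simp
  then show ?thesis
  proof (induction I rule: finite_induct)
    case empty
    then show ?case using tangent_space_zero by (simp add: tangent_of_def tangent_zero_def)
  next
    case (insert i I)
    then show ?case
      by (simp add: tangent_of_insert tangent_space_add tangent_space_scale coord_vector_tangent assms)
  qed
qed

lemma tangent_of_apply:
  assumes "c \<in> A" "c' \<in> A" "p \<in> chart_dom c" "p \<in> chart_dom c'"
  shows "tangent_of c p UNIV a c' = jac c c' p a"
proof -
  have "(\<Sum>i\<in>UNIV. a $ i *\<^sub>R axis i 1) = a"
    using basis_expansion[of a] unfolding scalar_mult_eq_scaleR .
  then have "jac c c' p a = jac c c' p (\<Sum>i\<in>UNIV. a $ i *\<^sub>R axis i 1)"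
    by (simp only:)
  also have "\<dots> = (\<Sum>i\<in>UNIV. a $ i *\<^sub>R jac c c' p (axis i 1))"
    by (simp only: linear_sum[OF linear_jac[OF assms]] linear_cmul[OF linear_jac[OF assms]])
  finally show ?thesis
    using assms by (simp add: tangent_of_def coord_vector_def)
qed

lemma tangent_of_components:
  assumes v: "v \<in> tangent_space A p" and c: "c \<in> A" "p \<in> chart_dom c"
  shows "tangent_of c p UNIV (v c) = v"
proof
  fix c'
  show "tangent_of c p UNIV (v c) c' = v c'"
  proof (cases "c' \<in> A \<and> p \<in> chart_dom c'")
    case True
    then have "v c' = jac c c' p (v c)"
      using tangent_spaceD(1)[OF v] c by blast
    then show ?thesis
      using True c by (simp only: tangent_of_apply)
  next
    case False
    then have "v c' = 0"
      using tangent_spaceD(2)[OF v] by blast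
    with False show ?thesis
      by (auto simp: tangent_of_def coord_vector_def)
  qed
qed

lemma tangent_component_nonzero:
  assumes "v \<in> tangent_space A p" "v \<noteq> tangent_zero" "c \<in> A" "p \<in> chart_dom c"
  shows "v c \<noteq> 0"
proof
  assume "v c = 0"
  then have "tangent_of c p UNIV (v c) = tangent_zero"
    by (simp add: tangent_of_def tangent_zero_def)
  with tangent_of_components[OF assms(1,3,4)] assms(2) show False by metis
qed

end

section \<open>Metrics in components\<close>

locale riemannian_manifold = manifold M A for M :: "'a topology" and A :: "('a, 'n::finite) chart set" +
  fixes g :: "('a, 'n) metric"
  assumes riemannian: "riemannian_metric M A g"
begin

lemma inner_product: "c \<in> A \<Longrightarrow> p \<in> chart_dom c \<Longrightarrow> inner_product_on_tangent A g p"
  using riemannian subsetD[OF chart_dom_subset] unfolding riemannian_metric_def by blast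

lemma metric_add:
  "c \<in> A \<Longrightarrow> p \<in> chart_dom c \<Longrightarrow> u \<in> tangent_space A p \<Longrightarrow> v \<in> tangent_space A p \<Longrightarrow>
    w \<in> tangent_space A p \<Longrightarrow> g p (tangent_add u v) w = g p u w + g p v w"
  using inner_product unfolding inner_product_on_tangent_def by blast

lemma metric_scale:
  "c \<in> A \<Longrightarrow> p \<in> chart_dom c \<Longrightarrow> u \<in> tangent_space A p \<Longrightarrow> v \<in> tangent_space A p \<Longrightarrow>
    g p (tangent_scale a u) v = a * g p u v"
  using inner_product unfolding inner_product_on_tangent_def by blast

lemma metric_tangent_of:
  assumes c: "c \<in> A" "p \<in> chart_dom c" and w: "w \<in> tangent_space A p"
  shows "g p (tangent_of c p I a) w = (\<Sum>i\<in>I. a $ i * g p (coord_vector A c i p) w)"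
proof -
  have "finite I" by simp
  then show ?thesis
  proof (induction I rule: finite_induct)
    case empty
    \<comment> \<open>The empty sum is the zero vector, obtained as \<open>0\<close> times
      \<open>w\<close> because homogeneity is what the metric axioms provide.\<close>
    have "g p (tangent_scale 0 w) w = 0 * g p w w"
      by (rule metric_scale[OF c w w])
    then show ?case by (simp add: tangent_of_def tangent_scale_def)
  next
    case (insert i I)
    have "g p (tangent_add (tangent_scale (a $ i) (coord_vector A c i p)) (tangent_of c p I a)) w =
        a $ i * g p (coord_vector A c i p) w + g p (tangent_of c p I a) w"
      by (simp add: metric_add[OF c] metric_scale[OF c] w coord_vector_tangent c tangent_space_scale
          tangent_of_tangent)
    with insert show ?case by (simp add: tangent_of_insert)
  qed
qed

lemma metric_sym:
  "c \<in> A \<Longrightarrow> p \<in> chart_dom c \<Longrightarrow> v \<in> tangent_space A p \<Longrightarrow> w \<in> tangent_space A p \<Longrightarrow> g p v w = g p w v"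
  using inner_product unfolding inner_product_on_tangent_def by blast

lemma metric_components:
  assumes c: "c \<in> A" "p \<in> chart_dom c" and v: "v \<in> tangent_space A p" and w: "w \<in> tangent_space A p"
  shows "g p v w = (\<Sum>i\<in>UNIV. \<Sum>j\<in>UNIV. metric_coeff A g c (chart_map c p) $ i $ j * v c $ i * w c $ j)"
proof -
  have "g p v w = (\<Sum>i\<in>UNIV. v c $ i * g p (coord_vector A c i p) w)"
    using metric_tangent_of[OF c w, of UNIV "v c"] by (simp add: tangent_of_components[OF v c])
  also have "\<dots> = (\<Sum>i\<in>UNIV. v c $ i * (\<Sum>j\<in>UNIV. w c $ j * g p (coord_vector A c i p) (coord_vector A c j p)))"
  proof (intro sum.cong refl)
    fix i
    have "g p (coord_vector A c i p) w = g p w (coord_vector A c i p)"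
      by (intro metric_sym[OF c] c w coord_vector_tangent)
    also have "\<dots> = (\<Sum>j\<in>UNIV. w c $ j * g p (coord_vector A c j p) (coord_vector A c i p))"
      using metric_tangent_of[OF c coord_vector_tangent[OF c], of UNIV "w c"]
      by (simp add: tangent_of_components[OF w c])
    also have "\<dots> = (\<Sum>j\<in>UNIV. w c $ j * g p (coord_vector A c i p) (coord_vector A c j p))"
      using metric_sym[OF c coord_vector_tangent[OF c] coord_vector_tangent[OF c]] by simp
    finally show "v c $ i * g p (coord_vector A c i p) w =
        v c $ i * (\<Sum>j\<in>UNIV. w c $ j * g p (coord_vector A c i p) (coord_vector A c j p))" by simp
  qed
  finally show ?thesis
    by (simp add: metric_coeff_def chart_inv_map[OF is_chart[OF c(1)] c(2)] sum_distrib_left mult_ac)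
qed

lemma metric_coeff_sym:
  assumes "c \<in> A" "x \<in> chart_image c"
  shows "metric_coeff A g c x $ i $ j = metric_coeff A g c x $ j $ i"
  using chart_map_inv[OF assms(2)] assms(1)
  by (simp add: metric_coeff_def Let_def metric_sym coord_vector_tangent)

lemma metric_coeff_pos:
  assumes c: "c \<in> A" "x \<in> chart_image c" and a: "a \<noteq> 0"
  shows "(\<Sum>i\<in>UNIV. \<Sum>j\<in>UNIV. metric_coeff A g c x $ i $ j * a $ i * a $ j) > 0"
proof -
  define p where "p = chart_inv c x"
  have p: "p \<in> chart_dom c" "chart_map c p = x"
    using chart_map_inv[OF c(2)] by (auto simp: p_def)
  let ?v = "tangent_of c p UNIV a"
  have v: "?v c = a"
    using tangent_of_apply[OF c(1) c(1) p(1) p(1)] jac_self[OF c(1) p(1)] by simp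
  have "?v \<noteq> tangent_zero"
    using v a by (metis tangent_zero_def)
  then have "g p ?v ?v > 0"
    using inner_product[OF c(1) p(1)] tangent_of_tangent[OF c(1) p(1)]
    unfolding inner_product_on_tangent_def by blast
  then show ?thesis
    using metric_components[OF c(1) p(1) tangent_of_tangent[OF c(1) p(1)] tangent_of_tangent[OF c(1) p(1)], of UNIV a UNIV a]
    by (simp add: v p(2))
qed

text \<open>A positive definite matrix has trivial kernel.\<close>

lemma metric_coeff_invertible:
  assumes "c \<in> A" "x \<in> chart_image c"
  shows "invertible (metric_coeff A g c x)"
proof -
  let ?B = "metric_coeff A g c x"
  have "a = 0" if "?B *v a = 0" for a
  proof (rule ccontr)
    assume "a \<noteq> 0"
    then have "(\<Sum>i\<in>UNIV. \<Sum>j\<in>UNIV. ?B $ i $ j * a $ i * a $ j) > 0"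
      by (rule metric_coeff_pos[OF assms])
    moreover have "(\<Sum>i\<in>UNIV. \<Sum>j\<in>UNIV. ?B $ i $ j * a $ i * a $ j) = (\<Sum>i\<in>UNIV. a $ i * (?B *v a) $ i)"
      by (simp add: matrix_vector_mult_def sum_distrib_left mult_ac)
    ultimately show False using that by simp
  qed
  then show ?thesis
    by (simp add: invertible_left_inverse matrix_left_invertible_ker)
qed

lemma smooth_metric_coeff: "c \<in> A \<Longrightarrow> smooth_on (\<lambda>x. metric_coeff A g c x $ i $ j) (chart_image c)"
  using riemannian by (intro smooth_on_nth open_chart_image) (simp_all add: riemannian_metric_def)

end

text \<open>The rescaled metric, for which \<open>X\<close> is parallel, takes the role of the base
  metric \<open>g\<close> of the locale, and the given metric that of \<open>G\<close>; hence the
  exponent \<open>- f\<close>.\<close>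

lemma conformal_parallel_chart:
  fixes M :: "'a topology" and A :: "('a, 3) chart set"
  assumes M: "smooth_manifold M A" and g: "riemannian_metric M A g" and f: "smooth_fun A f"
    and X: "vector_field M A X" "\<forall>p\<in>topspace M. X p \<noteq> tangent_zero"
    and par: "parallel A (\<lambda>p v w. exp (2 * f p) * g p v w) X" and c: "c \<in> A"
  defines "H \<equiv> metric_coeff A (\<lambda>p v w. exp (2 * f p) * g p v w) c"
  shows "conformal_parallel_3 (chart_image c) H (\<lambda>y. X (chart_inv c y) c) (\<lambda>y. - f (chart_inv c y))
    (metric_coeff A g c)"
proof -
  interpret riemannian_manifold M A g
    by unfold_locales (fact M g)+
  have H: "H y = exp (2 * f (chart_inv c y)) *\<^sub>R metric_coeff A g c y" for y
    by (simp add: H_def metric_coeff_def vec_eq_iff Let_def)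
  have U: "open (chart_image c)" by (rule open_chart_image[OF c])
  have sf: "smooth_on (\<lambda>y. f (chart_inv c y)) (chart_image c)"
    using f c by (simp add: smooth_fun_def o_def)
  show ?thesis
  proof (unfold_locales)
    show "open (chart_image c)" by (rule U)
    show "smooth_on (\<lambda>x. H x $ i $ j) (chart_image c)" for i j
      unfolding H using sf
      by (simp, intro smooth_on_mult smooth_on_exp smooth_on_const smooth_metric_coeff[OF c] U)
    show "H x $ i $ j = H x $ j $ i" if "x \<in> chart_image c" for x i j
      unfolding H using metric_coeff_sym[OF c that, of i j] by simp
    show "invertible (H x)" if "x \<in> chart_image c" for x
      unfolding H using metric_coeff_invertible[OF c that] by (intro scalar_invertible) simp_all
    show "smooth_on (\<lambda>y. X (chart_inv c y) c $ k) (chart_image c)" for k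
      using X(1) c by (intro smooth_on_nth U) (simp add: vector_field_def)
    show "covariant_deriv_vec H (\<lambda>y. X (chart_inv c y) c) i k x = 0" if "x \<in> chart_image c" for x i k
      using par c that unfolding parallel_def H_def by blast
    show "(\<Sum>k\<in>UNIV. (\<Sum>m\<in>UNIV. H x $ k $ m * X (chart_inv c x) c $ m) * X (chart_inv c x) c $ k) \<noteq> 0"
      if x: "x \<in> chart_image c" for x
    proof -
      define p where "p = chart_inv c x"
      have p: "p \<in> chart_dom c" using chart_map_inv[OF x] by (simp add: p_def)
      then have pM: "p \<in> topspace M" using chart_dom_subset[OF c] by blast
      then have "X p \<in> tangent_space A p" "X p \<noteq> tangent_zero"
        using X by (auto simp: vector_field_def)
      then have "X p c \<noteq> 0" by (rule tangent_component_nonzero[OF _ _ c p])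
      then have "exp (2 * f p) * (\<Sum>i\<in>UNIV. \<Sum>j\<in>UNIV. metric_coeff A g c x $ i $ j * X p c $ i * X p c $ j) > 0"
        using metric_coeff_pos[OF c x] by simp
      also have "exp (2 * f p) * (\<Sum>i\<in>UNIV. \<Sum>j\<in>UNIV. metric_coeff A g c x $ i $ j * X p c $ i * X p c $ j) =
          (\<Sum>k\<in>UNIV. (\<Sum>m\<in>UNIV. H x $ k $ m * X p c $ m) * X p c $ k)"
        by (simp add: H p_def[symmetric] sum_distrib_left sum_distrib_right mult_ac)
      finally show ?thesis by (simp add: p_def)
    qed
    show "smooth_on (\<lambda>y. - f (chart_inv c y)) (chart_image c)"
      by (intro smooth_on_minus U sf)
    show "metric_coeff A g c x = exp (2 * - f (chart_inv c x)) *\<^sub>R H x" if "x \<in> chart_image c" for x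
      unfolding H by (simp add: exp_minus)
  qed
qed

theorem theorem1p6:
  fixes M :: "'a topology" and A :: "('a, 3) chart set" and g :: "('a, 3) metric"
  assumes "smooth_manifold M A"
    and "riemannian_metric M A g"
    and "\<exists>g' \<in> conformal_class A g. \<exists>X. vector_field M A X \<and>
           (\<forall>p\<in>topspace M. X p \<noteq> tangent_zero) \<and> parallel A g' X"
  shows "\<forall>p\<in>topspace M. \<exists>v\<in>tangent_space A p. v \<noteq> tangent_zero \<and>
           (\<forall>c\<in>A. p \<in> chart_dom c \<longrightarrow>
              cotton_york A g c p v v = 0 \<and>
              (\<forall>w\<^sub>1\<in>orth_compl A g p v. \<forall>w\<^sub>2\<in>orth_compl A g p v.
                 cotton_york A g c p w\<^sub>1 w\<^sub>2 = 0))"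
proof
  fix p assume p: "p \<in> topspace M"
  interpret riemannian_manifold M A g
    by unfold_locales (fact assms)+
  obtain f X where f: "smooth_fun A f" and X: "vector_field M A X" "\<forall>p\<in>topspace M. X p \<noteq> tangent_zero"
    and par: "parallel A (\<lambda>p v w. exp (2 * f p) * g p v w) X"
    using assms(3) unfolding conformal_class_def by blast
  have Xp: "X p \<in> tangent_space A p" "X p \<noteq> tangent_zero"
    using X p by (auto simp: vector_field_def)
  \<comment> \<open>The witness \<open>X p\<close> does not depend on a chart, so one vector serves
    every chart around \<open>p\<close> and thereby both local orientations.\<close>
  have "cotton_york A g c p (X p) (X p) = 0 \<and>
      (\<forall>w\<^sub>1\<in>orth_compl A g p (X p). \<forall>w\<^sub>2\<in>orth_compl A g p (X p). cotton_york A g c p w\<^sub>1 w\<^sub>2 = 0)"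
    if c: "c \<in> A" and pc: "p \<in> chart_dom c" for c
  proof -
    interpret L: conformal_parallel_3 "chart_image c" "metric_coeff A (\<lambda>p v w. exp (2 * f p) * g p v w) c"
      "\<lambda>y. X (chart_inv c y) c" "\<lambda>y. - f (chart_inv c y)" "metric_coeff A g c"
      by (rule conformal_parallel_chart[OF assms(1,2) f X par c])
    have x: "chart_map c p \<in> chart_image c" using pc by (simp add: chart_image_def)
    have inv: "chart_inv c (chart_map c p) = p" by (rule chart_inv_map[OF is_chart[OF c] pc])
    have orth: "(\<Sum>i\<in>UNIV. \<Sum>j\<in>UNIV. metric_coeff A g c (chart_map c p) $ i $ j * X p c $ i * w c $ j) = 0"
      if "w \<in> orth_compl A g p (X p)" for w
    proof -
      have "w \<in> tangent_space A p" "g p (X p) w = 0"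
        using that by (auto simp: orth_compl_def)
      with metric_components[OF c pc Xp(1), of w] show ?thesis by linarith
    qed
    show ?thesis
      unfolding cotton_york_def
      using L.cotton_york_parallel[OF x] orth by (simp add: inv)
  qed
  with Xp show "\<exists>v\<in>tangent_space A p. v \<noteq> tangent_zero \<and>
           (\<forall>c\<in>A. p \<in> chart_dom c \<longrightarrow>
              cotton_york A g c p v v = 0 \<and>
              (\<forall>w\<^sub>1\<in>orth_compl A g p v. \<forall>w\<^sub>2\<in>orth_compl A g p v.
                 cotton_york A g c p w\<^sub>1 w\<^sub>2 = 0))"
    by blast
qed

end
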